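(* Let $L$ be any lattice that admits a lattice homomorphism onto a free bounded lattice with $\aleph_2$ generators in the variety generated by either $M_3$ or $N_5$. Then $\mathrm{Con_c}\,L$ does not satisfy $\mathrm{WURP}^{=}$. In particular, there exists no V-distance of type $3/2$ with range join-generating $\mathrm{Con_c}\,L$. Hence there is no algebra $A$ with almost permutable congruences such that $\mathrm{Con}\,L\cong\mathrm{Con}\,A$.
   Context: For an algebra $A$, $\mathrm{Con}\,A$ denotes the lattice of all congruences of $A$ and $\mathrm{Con_c}\,A$ the $\langle\vee,0\rangle$-semilattice of all compact (i.e., finitely generated) congruences of $A$. An algebra $A$ has almost permutable congruences if $\alpha\vee\beta=\alpha\beta\cup\beta\alpha$ for all congruences $\alpha,\beta$ of $A$, where $\alpha\beta$ denotes composition of relations. $M_3$ is the five-element modular non-distributive lattice (diamond) and $N_5$ is the five-element non-modular lattice (pentagon). Let $S$ be a $\langle\vee,0\rangle$-semilattice and $X$ a set. A map $\delta\colon X\times X\to S$ is an $S$-valued distance on $X$ if $\delta(x,x)=0$, $\delta(x,y)=\delta(y,x)$, and $\delta(x,z)\leq\delta(x,y)\vee\delta(y,z)$ for all $x,y,z\in X$. An $S$-valued distance $\delta$ on $X$ is a V-distance of type $3/2$ if for all $x,y\in X$ and all $a,b\in S$ such that $\delta(x,y)\leq a\vee b$, there exists $z\in X$ such that either ($\delta(x,z)\leq a$ and $\delta(z,y)\leq b$) or ($\delta(x,z)\leq b$ and $\delta(z,y)\leq a$). The range of $\delta$ join-generates $S$ if every element of $S$ is a finite join of elements of the range of $\delta$.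 Let $e\in S$. We say that $S$ satisfies $\mathrm{WURP}^{=}(e)$ if there exists a positive integer $m$ such that for all families $(a_i)_{i\in I}$ and $(b_i)_{i\in I}$ of elements of $S$ (with the same index set $I$) such that $e\leq a_i\vee b_i$ for all $i\in I$, there are subsets $I_u$ ($0\leq u<m$) of $I$ with $\bigcup_{u<m}I_u=I$ and a family $(c_{i,j})_{(i,j)\in I\times I}$ of elements of $S$ such that: (i) $c_{i,j}\leq a_i\vee a_j$ and $c_{i,j}\leq b_i\vee b_j$, for all $u<m$ and all $i,j\in I_u$; (ii) $e\leq a_j\vee b_i\vee c_{i,j}$, for all $u<m$ and all $i,j\in I_u$; (iii) $c_{i,k}\leq c_{i,j}\vee c_{j,k}$, for all $i,j,k\in I$. We say that $S$ satisfies $\mathrm{WURP}^{=}$ if $S$ satisfies $\mathrm{WURP}^{=}(e)$ for all $e\in S$. *)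

theory Defs
  imports "HOL-Algebra.Complete_Lattice"
begin

unbundle cardinal_syntax

section \<open>Algebras and their congruences\<close>

record ('a, 'o) univ_algebra = "'a partial_object" +
  symbols :: "'o set"
  arity :: "'o \<Rightarrow> nat"
  interp :: "'o \<Rightarrow> 'a list \<Rightarrow> 'a"

text \<open>Only finitary operations; nullary ones and the empty algebra are allowed.\<close>

definition is_algebra :: "('a, 'o) univ_algebra \<Rightarrow> bool" where
  "is_algebra A \<longleftrightarrow>
     (\<forall>f\<in>symbols A. \<forall>xs. set xs \<subseteq> carrier A \<and> length xs = arity A f
        \<longrightarrow> interp A f xs \<in> carrier A)"

definition congruences :: "('a, 'o) univ_algebra \<Rightarrow> ('a \<times> 'a) set set" where
  "congruences A = {\<theta>. equiv (carrier A) \<theta> \<and>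
     (\<forall>f\<in>symbols A. \<forall>xs ys. length xs = arity A f \<and> list_all2 (\<lambda>x y. (x, y) \<in> \<theta>) xs ys
        \<longrightarrow> (interp A f xs, interp A f ys) \<in> \<theta>)}"

definition congruence_generated ::
  "('a, 'o) univ_algebra \<Rightarrow> ('a \<times> 'a) set \<Rightarrow> ('a \<times> 'a) set" where
  "congruence_generated A R = \<Inter>{\<theta> \<in> congruences A. R \<subseteq> \<theta>}"

definition Con :: "('a, 'o) univ_algebra \<Rightarrow> ('a \<times> 'a) set gorder" where
  "Con A = \<lparr>carrier = congruences A, eq = (=), le = (\<subseteq>)\<rparr>"

definition Con_c :: "('a, 'o) univ_algebra \<Rightarrow> ('a \<times> 'a) set gorder" where
  "Con_c A = \<lparr>carrier = {congruence_generated A R |R. finite R \<and> R \<subseteq> carrier A \<times> carrier A},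
              eq = (=), le = (\<subseteq>)\<rparr>"

definition almost_permutable_congruences :: "('a, 'o) univ_algebra \<Rightarrow> bool" where
  "almost_permutable_congruences A \<longleftrightarrow>
     (\<forall>\<alpha>\<in>congruences A. \<forall>\<beta>\<in>congruences A. \<alpha> \<squnion>\<^bsub>Con A\<^esub> \<beta> = (\<alpha> O \<beta>) \<union> (\<beta> O \<alpha>))"


section \<open>Lattices, varieties and free bounded lattices\<close>

datatype lattice_op = Join_op | Meet_op

definition lattice_algebra :: "'a gorder \<Rightarrow> ('a, lattice_op) univ_algebra" where
  "lattice_algebra L = \<lparr>carrier = carrier L, symbols = UNIV, arity = (\<lambda>_. 2),
     interp = (\<lambda>f xs. case f of Join_op \<Rightarrow> xs ! 0 \<squnion>\<^bsub>L\<^esub> xs ! 1 | Meet_op \<Rightarrow> xs ! 0 \<sqinter>\<^bsub>L\<^esub> xs ! 1)\<rparr>"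

definition lattice_hom :: "'a gorder \<Rightarrow> 'b gorder \<Rightarrow> ('a \<Rightarrow> 'b) \<Rightarrow> bool" where
  "lattice_hom K L h \<longleftrightarrow> h \<in> carrier K \<rightarrow> carrier L \<and> join_pres K L h \<and> meet_pres K L h"

definition lattice_isomorphic :: "'a gorder \<Rightarrow> 'b gorder \<Rightarrow> bool" where
  "lattice_isomorphic K L \<longleftrightarrow> (\<exists>h. lattice_hom K L h \<and> bij_betw h (carrier K) (carrier L))"

definition bounded_lattice_hom :: "'a gorder \<Rightarrow> 'b gorder \<Rightarrow> ('a \<Rightarrow> 'b) \<Rightarrow> bool" where
  "bounded_lattice_hom K L h \<longleftrightarrow>
     lattice_hom K L h \<and> h \<bottom>\<^bsub>K\<^esub> = \<bottom>\<^bsub>L\<^esub> \<and> h \<top>\<^bsub>K\<^esub> = \<top>\<^bsub>L\<^esub>"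

datatype lattice_term = Var nat | Join lattice_term lattice_term | Meet lattice_term lattice_term

primrec eval_term :: "'a gorder \<Rightarrow> (nat \<Rightarrow> 'a) \<Rightarrow> lattice_term \<Rightarrow> 'a" where
  "eval_term L \<rho> (Var n) = \<rho> n"
| "eval_term L \<rho> (Join s t) = eval_term L \<rho> s \<squnion>\<^bsub>L\<^esub> eval_term L \<rho> t"
| "eval_term L \<rho> (Meet s t) = eval_term L \<rho> s \<sqinter>\<^bsub>L\<^esub> eval_term L \<rho> t"

definition satisfies_identity :: "'a gorder \<Rightarrow> lattice_term \<Rightarrow> lattice_term \<Rightarrow> bool" where
  "satisfies_identity L s t \<longleftrightarrow> (\<forall>\<rho> \<in> UNIV \<rightarrow> carrier L. eval_term L \<rho> s = eval_term L \<rho> t)"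

text \<open>A variety is an equational class, so the least variety containing \<open>K\<close> consists of the
  lattices that satisfy all identities of \<open>K\<close>.\<close>

definition in_variety_generated_by :: "'k gorder \<Rightarrow> 'a gorder \<Rightarrow> bool" where
  "in_variety_generated_by K L \<longleftrightarrow> lattice L \<and>
     (\<forall>s t. satisfies_identity K s t \<longrightarrow> satisfies_identity L s t)"

definition bounded_lattice_generated_by :: "'a set \<Rightarrow> 'a gorder \<Rightarrow> bool" where
  "bounded_lattice_generated_by X F \<longleftrightarrow> X \<subseteq> carrier F \<and>
     (\<forall>Y. X \<subseteq> Y \<and> Y \<subseteq> carrier F \<and> \<bottom>\<^bsub>F\<^esub> \<in> Y \<and> \<top>\<^bsub>F\<^esub> \<in> Y \<and>
          (\<forall>x\<in>Y. \<forall>y\<in>Y. x \<squnion>\<^bsub>F\<^esub> y \<in> Y \<and> x \<sqinter>\<^bsub>F\<^esub> y \<in> Y) \<longrightarrow> Y = carrier F)"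

text \<open>\<open>F\<close> is the free bounded lattice on the generating set \<open>X\<close> in the lattice variety generated by
  \<open>K\<close>: the bounds are constants of the signature, so homomorphisms preserve them, while the identities
  defining the variety are lattice identities. HOL cannot quantify over the carrier type
  of the target \<open>B\<close>, so \<open>B\<close> ranges over the bounded lattices whose carrier is a subset of the type of
  \<open>F\<close>. For infinite \<open>X\<close> this loses nothing: the image of \<open>X\<close> in any target generates a bounded
  sublattice of cardinality at most that of \<open>X\<close>, which has a copy inside the type of \<open>F\<close>.\<close>

definition free_bounded_lattice :: "'k gorder \<Rightarrow> 'a set \<Rightarrow> 'a gorder \<Rightarrow> bool" where
  "free_bounded_lattice K X F \<longleftrightarrow>
     bounded_lattice F \<and> in_variety_generated_by K F \<and> bounded_lattice_generated_by X F \<and>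
     (\<forall>(B :: 'a gorder) g. bounded_lattice B \<and> in_variety_generated_by K B \<and> g \<in> X \<rightarrow> carrier B
        \<longrightarrow> (\<exists>h. bounded_lattice_hom F B h \<and> (\<forall>x\<in>X. h x = g x)))"

datatype five = Zero5 | P5 | Q5 | R5 | One5

definition M\<^sub>3 :: "five gorder" where
  "M\<^sub>3 = \<lparr>carrier = UNIV, eq = (=), le = (\<lambda>x y. x = y \<or> x = Zero5 \<or> y = One5)\<rparr>"

definition N\<^sub>5 :: "five gorder" where
  "N\<^sub>5 = \<lparr>carrier = UNIV, eq = (=),
        le = (\<lambda>x y. x = y \<or> x = Zero5 \<or> y = One5 \<or> (x = P5 \<and> y = Q5))\<rparr>"


section \<open>Distances and the uniform refinement property\<close>

text \<open>In this section \<open>S\<close> is meant to be a join-semilattice with least element.\<close>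

definition S_valued_distance :: "'s gorder \<Rightarrow> 'x set \<Rightarrow> ('x \<Rightarrow> 'x \<Rightarrow> 's) \<Rightarrow> bool" where
  "S_valued_distance S X \<delta> \<longleftrightarrow>
     (\<forall>x\<in>X. \<forall>y\<in>X. \<delta> x y \<in> carrier S) \<and>
     (\<forall>x\<in>X. \<delta> x x = \<bottom>\<^bsub>S\<^esub>) \<and>
     (\<forall>x\<in>X. \<forall>y\<in>X. \<delta> x y = \<delta> y x) \<and>
     (\<forall>x\<in>X. \<forall>y\<in>X. \<forall>z\<in>X. \<delta> x z \<sqsubseteq>\<^bsub>S\<^esub> \<delta> x y \<squnion>\<^bsub>S\<^esub> \<delta> y z)"

definition V_distance_3_2 :: "'s gorder \<Rightarrow> 'x set \<Rightarrow> ('x \<Rightarrow> 'x \<Rightarrow> 's) \<Rightarrow> bool" where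
  "V_distance_3_2 S X \<delta> \<longleftrightarrow> S_valued_distance S X \<delta> \<and>
     (\<forall>x\<in>X. \<forall>y\<in>X. \<forall>a\<in>carrier S. \<forall>b\<in>carrier S. \<delta> x y \<sqsubseteq>\<^bsub>S\<^esub> a \<squnion>\<^bsub>S\<^esub> b \<longrightarrow>
        (\<exists>z\<in>X. (\<delta> x z \<sqsubseteq>\<^bsub>S\<^esub> a \<and> \<delta> z y \<sqsubseteq>\<^bsub>S\<^esub> b) \<or> (\<delta> x z \<sqsubseteq>\<^bsub>S\<^esub> b \<and> \<delta> z y \<sqsubseteq>\<^bsub>S\<^esub> a)))"

definition range_join_generates :: "'s gorder \<Rightarrow> 'x set \<Rightarrow> ('x \<Rightarrow> 'x \<Rightarrow> 's) \<Rightarrow> bool" where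
  "range_join_generates S X \<delta> \<longleftrightarrow>
     (\<forall>s\<in>carrier S. \<exists>T. finite T \<and> T \<subseteq> {\<delta> x y |x y. x \<in> X \<and> y \<in> X} \<and> s = \<Squnion>\<^bsub>S\<^esub>T)"

definition WURP_eq_families :: "nat \<Rightarrow> 'i set \<Rightarrow> 's gorder \<Rightarrow> 's \<Rightarrow> bool" where
  "WURP_eq_families m I S e \<longleftrightarrow>
     (\<forall>a b. a \<in> I \<rightarrow> carrier S \<and> b \<in> I \<rightarrow> carrier S \<and> (\<forall>i\<in>I. e \<sqsubseteq>\<^bsub>S\<^esub> a i \<squnion>\<^bsub>S\<^esub> b i) \<longrightarrow>
       (\<exists>(J :: nat \<Rightarrow> 'i set) (c :: 'i \<Rightarrow> 'i \<Rightarrow> 's).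
          (\<Union>u<m. J u) = I \<and>
          (\<forall>i\<in>I. \<forall>j\<in>I. c i j \<in> carrier S) \<and>
          (\<forall>u<m. \<forall>i\<in>J u. \<forall>j\<in>J u. c i j \<sqsubseteq>\<^bsub>S\<^esub> a i \<squnion>\<^bsub>S\<^esub> a j \<and> c i j \<sqsubseteq>\<^bsub>S\<^esub> b i \<squnion>\<^bsub>S\<^esub> b j) \<and>
          (\<forall>u<m. \<forall>i\<in>J u. \<forall>j\<in>J u. e \<sqsubseteq>\<^bsub>S\<^esub> a j \<squnion>\<^bsub>S\<^esub> b i \<squnion>\<^bsub>S\<^esub> c i j) \<and>
          (\<forall>i\<in>I. \<forall>j\<in>I. \<forall>k\<in>I. c i k \<sqsubseteq>\<^bsub>S\<^esub> c i j \<squnion>\<^bsub>S\<^esub> c j k)))"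

text \<open>The index set is arbitrary in the mathematics. Since \<open>i \<mapsto> (a i, b i)\<close> can serve as an indexing,
  it suffices to let it range over sets of pairs of elements of \<open>S\<close>; the lemma below shows that
  all other index types are then covered, with the same \<open>m\<close>.\<close>

definition WURP_eq_at :: "'s gorder \<Rightarrow> 's \<Rightarrow> bool" where
  "WURP_eq_at S e \<longleftrightarrow> (\<exists>m>0. \<forall>I :: ('s \<times> 's) set. WURP_eq_families m I S e)"

definition WURP_eq :: "'s gorder \<Rightarrow> bool" where
  "WURP_eq S \<longleftrightarrow> (\<forall>e\<in>carrier S. WURP_eq_at S e)"

lemma WURP_eq_families_any_index_type:
  fixes S :: "'s gorder" and I :: "'i set"
  assumes "\<forall>I' :: ('s \<times> 's) set. WURP_eq_families m I' S e"
  shows "WURP_eq_families m I S e"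
  unfolding WURP_eq_families_def
proof (intro allI impI)
  fix a b
  assume ab: "a \<in> I \<rightarrow> carrier S \<and> b \<in> I \<rightarrow> carrier S \<and> (\<forall>i\<in>I. e \<sqsubseteq>\<^bsub>S\<^esub> a i \<squnion>\<^bsub>S\<^esub> b i)"
  let ?p = "\<lambda>i. (a i, b i)"
  let ?I = "?p ` I"
  have fam: "WURP_eq_families m ?I S e" using assms by blast
  have "fst \<in> ?I \<rightarrow> carrier S \<and> snd \<in> ?I \<rightarrow> carrier S \<and>
      (\<forall>i\<in>?I. e \<sqsubseteq>\<^bsub>S\<^esub> fst i \<squnion>\<^bsub>S\<^esub> snd i)"
    using ab by auto
  from fam[unfolded WURP_eq_families_def, THEN spec, THEN spec, THEN mp, OF this] obtain J c where
      J: "(\<Union>u<m. J u) = ?I"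
    and c: "\<forall>i\<in>?I. \<forall>j\<in>?I. c i j \<in> carrier S"
      "\<forall>u<m. \<forall>i\<in>J u. \<forall>j\<in>J u. c i j \<sqsubseteq>\<^bsub>S\<^esub> fst i \<squnion>\<^bsub>S\<^esub> fst j \<and> c i j \<sqsubseteq>\<^bsub>S\<^esub> snd i \<squnion>\<^bsub>S\<^esub> snd j"
      "\<forall>u<m. \<forall>i\<in>J u. \<forall>j\<in>J u. e \<sqsubseteq>\<^bsub>S\<^esub> fst j \<squnion>\<^bsub>S\<^esub> snd i \<squnion>\<^bsub>S\<^esub> c i j"
      "\<forall>i\<in>?I. \<forall>j\<in>?I. \<forall>k\<in>?I. c i k \<sqsubseteq>\<^bsub>S\<^esub> c i j \<squnion>\<^bsub>S\<^esub> c j k"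
    by (elim exE conjE)
  define J' where "J' u = {i \<in> I. ?p i \<in> J u}" for u
  define c' where "c' i j = c (?p i) (?p j)" for i j
  have "(\<Union>u<m. J' u) = I" using J unfolding J'_def by blast
  moreover have "\<forall>i\<in>I. \<forall>j\<in>I. c' i j \<in> carrier S" using c(1) unfolding c'_def by blast
  moreover have "\<forall>u<m. \<forall>i\<in>J' u. \<forall>j\<in>J' u. c' i j \<sqsubseteq>\<^bsub>S\<^esub> a i \<squnion>\<^bsub>S\<^esub> a j \<and> c' i j \<sqsubseteq>\<^bsub>S\<^esub> b i \<squnion>\<^bsub>S\<^esub> b j"
    using c(2) unfolding J'_def c'_def by fastforce
  moreover have "\<forall>u<m. \<forall>i\<in>J' u. \<forall>j\<in>J' u. e \<sqsubseteq>\<^bsub>S\<^esub> a j \<squnion>\<^bsub>S\<^esub> b i \<squnion>\<^bsub>S\<^esub> c' i j"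
    using c(3) unfolding J'_def c'_def by fastforce
  moreover have "\<forall>i\<in>I. \<forall>j\<in>I. \<forall>k\<in>I. c' i k \<sqsubseteq>\<^bsub>S\<^esub> c' i j \<squnion>\<^bsub>S\<^esub> c' j k"
    using c(4) unfolding c'_def by blast
  ultimately show "\<exists>(J :: nat \<Rightarrow> 'i set) (c :: 'i \<Rightarrow> 'i \<Rightarrow> 's).
          (\<Union>u<m. J u) = I \<and>
          (\<forall>i\<in>I. \<forall>j\<in>I. c i j \<in> carrier S) \<and>
          (\<forall>u<m. \<forall>i\<in>J u. \<forall>j\<in>J u. c i j \<sqsubseteq>\<^bsub>S\<^esub> a i \<squnion>\<^bsub>S\<^esub> a j \<and> c i j \<sqsubseteq>\<^bsub>S\<^esub> b i \<squnion>\<^bsub>S\<^esub> b j) \<and>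
          (\<forall>u<m. \<forall>i\<in>J u. \<forall>j\<in>J u. e \<sqsubseteq>\<^bsub>S\<^esub> a j \<squnion>\<^bsub>S\<^esub> b i \<squnion>\<^bsub>S\<^esub> c i j) \<and>
          (\<forall>i\<in>I. \<forall>j\<in>I. \<forall>k\<in>I. c i k \<sqsubseteq>\<^bsub>S\<^esub> c i j \<squnion>\<^bsub>S\<^esub> c j k)"
    by blast
qed

end

theory Submission
  imports Defs
begin

text \<open>
  All three assertions reduce to the failure of \<open>WURP\<^sup>=\<close>. If \<open>A\<close> has almost permutable congruences,
  then \<open>(x, y) \<mapsto> \<Theta>(x, y)\<close> is a V-distance of type 3/2 on \<open>A\<close> whose range join-generates the
  compact congruences, and an isomorphism \<open>Con L \<cong> Con A\<close> carries it to \<open>Con\<^sub>c L\<close>, because lattice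
  isomorphisms preserve compactness (\<open>almost_permutable_gives_V_distance\<close>). Any such distance
  yields \<open>WURP\<^sup>=\<close>: write \<open>e\<close> as a finite join of distances \<open>\<delta>(x, y)\<close>, interpolate a point \<open>z\<^sub>i\<close>
  between \<open>x\<close> and \<open>y\<close> for every inequality \<open>e \<le> a\<^sub>i \<or> b\<^sub>i\<close>, and let \<open>c\<^sub>i\<^sub>j\<close> be the join of the
  distances \<open>\<delta>(z\<^sub>i, z\<^sub>j)\<close>; the sets \<open>I\<^sub>u\<close> record in which order \<open>a\<^sub>i\<close> and \<open>b\<^sub>i\<close> occur around \<open>z\<^sub>i\<close>
  (\<open>V_distance_3_2_imp_WURP_eq\<close>).

  The failure of \<open>WURP\<^sup>=\<close> at \<open>e = \<Theta>(0, 1)\<close> is \<open>not_WURP_eq_free\<close>. Index the generators of \<open>F\<close> in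
  pairs \<open>u\<^sub>l, v\<^sub>l\<close>, and put \<open>a\<^sub>l = \<Theta>(0, u\<^sub>l) \<or> \<Theta>(v\<^sub>l, 1)\<close> and \<open>b\<^sub>l = \<Theta>(u\<^sub>l, v\<^sub>l)\<close>: on the path
  \<open>0, u\<^sub>l, v\<^sub>l, 1\<close> the two congruences occur in the order \<open>a\<^sub>l, b\<^sub>l, a\<^sub>l\<close>, so one intermediate point
  cannot separate them. Suppose there were subsets \<open>I\<^sub>u\<close> and congruences \<open>c\<^sub>i\<^sub>j\<close>. One of the finitely
  many \<open>I\<^sub>u\<close> still has \<open>\<aleph>\<^sub>2\<close> elements. Each \<open>c\<^sub>i\<^sub>j\<close> is generated by finitely many pairs, hence
  involves only finitely many generators, so Kuratowski's free set theorem provides distinct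
  \<open>i, j, k\<close> in this subset such that \<open>c\<^sub>i\<^sub>j\<close> does not involve the generators with index \<open>k\<close>, nor
  \<open>c\<^sub>j\<^sub>k\<close> those with index \<open>i\<close>, nor \<open>c\<^sub>i\<^sub>k\<close> those with index \<open>j\<close>.

  Let \<open>K\<close> be \<open>M\<^sub>3\<close> or \<open>N\<^sub>5\<close>, with \<open>R\<close> a complement of both \<open>P\<close> and \<open>Q\<close>, and send \<open>(u, v)\<close> to
  \<open>(0, P)\<close>, \<open>(R, 1)\<close> and \<open>(0, Q)\<close> at \<open>i\<close>, \<open>j\<close> and \<open>k\<close>, respectively. A homomorphism with value
  \<open>(0, 1)\<close> at \<open>l\<close> trivializes \<open>a\<^sub>l\<close>, one with equal values \<open>u\<^sub>l = v\<^sub>l\<close> trivializes \<open>b\<^sub>l\<close>. The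
  sublattice \<open>{0, P, R, 1}\<close> is the square of the two-element chain. In one coordinate the values
  at \<open>i\<close> and \<open>j\<close> are both \<open>(0, 1)\<close>, in the other they are \<open>(0, 0)\<close> and \<open>(1, 1)\<close>; so condition (i)
  makes \<open>c\<^sub>i\<^sub>j\<close> trivial in both coordinates, hence in \<open>K\<close>. The same holds for \<open>c\<^sub>j\<^sub>k\<close>, with \<open>Q\<close>
  instead of \<open>P\<close>. But \<open>{0, P, Q, 1}\<close> has a homomorphism to \<open>{0, 1}\<close> with \<open>P \<mapsto> 0\<close> and \<open>Q \<mapsto> 1\<close>,
  which gives the value \<open>(0, 0)\<close> at \<open>i\<close> and \<open>(0, 1)\<close> at \<open>k\<close>; if \<open>c\<^sub>i\<^sub>k\<close> were trivial there,
  condition (ii) would identify \<open>0\<close> and \<open>1\<close>. So \<open>c\<^sub>i\<^sub>k\<close> is not trivial in \<open>K\<close>, against (iii).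
\<close>

section \<open>Suprema and infima in partial orders\<close>

lemma join_eq_lub:
  assumes "partial_order P" "is_lub P s {x, y}"
  shows "x \<squnion>\<^bsub>P\<^esub> y = s"
proof -
  interpret partial_order P by fact
  show ?thesis
    unfolding join_def Lattice.sup_def using assms(2) least_unique by (blast intro: some_equality)
qed

lemma sup_eq_lub:
  assumes "partial_order P" "is_lub P s A"
  shows "\<Squnion>\<^bsub>P\<^esub>A = s"
proof -
  interpret partial_order P by fact
  show ?thesis
    unfolding Lattice.sup_def using assms(2) least_unique by (blast intro: some_equality)
qed

lemma bottom_eq_least:
  assumes "partial_order P" "least P s (carrier P)"
  shows "\<bottom>\<^bsub>P\<^esub> = s"
proof -
  interpret partial_order P by fact
  show ?thesis
    unfolding bottom_def using assms(2) least_unique by (blast intro: some_equality)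
qed

lemma meet_eq_glb:
  assumes "partial_order P" "is_glb P s {x, y}"
  shows "x \<sqinter>\<^bsub>P\<^esub> y = s"
proof -
  interpret partial_order P by fact
  show ?thesis
    unfolding meet_def Lattice.inf_def using assms(2) greatest_unique by (blast intro: some_equality)
qed

lemma top_eq_greatest:
  assumes "partial_order P" "greatest P s (carrier P)"
  shows "\<top>\<^bsub>P\<^esub> = s"
proof -
  interpret partial_order P by fact
  show ?thesis
    unfolding top_def using assms(2) greatest_unique by (blast intro: some_equality)
qed

lemma lattice_hom_compose:
  assumes "lattice_hom K L f" "lattice_hom L M g"
  shows "lattice_hom K M (g \<circ> f)"
  using assms unfolding lattice_hom_def join_pres_def meet_pres_def by (auto simp: Pi_iff)

section \<open>Distances of type 3/2 and uniform refinement\<close>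

text \<open>The empty family is included: its supremum is the least element.\<close>

lemma finite_sup_is_lub:
  assumes "upper_semilattice S" "weak_partial_order_bottom S" "finite A" "A \<subseteq> carrier S"
  shows "is_lub S (\<Squnion>\<^bsub>S\<^esub>A) A"
proof (cases "A = {}")
  case True
  interpret weak_partial_order_bottom S by fact
  show ?thesis
    using bottom_least True by (simp add: Lattice.sup_def bottom_def)
next
  case False
  interpret upper_semilattice S by fact
  show ?thesis using assms False by (intro finite_sup_least)
qed

text \<open>
  The element \<open>e\<close> is a join of distances \<open>\<delta> x y\<close> over a finite set \<open>P\<close> of pairs. For each index \<open>i\<close> and
  each pair in \<open>P\<close> there is an interpolating point, which is reached either through \<open>a i\<close> first or through
  \<open>b i\<close> first. There are \<open>2 ^ card P\<close> possible patterns of such choices, and this number does not depend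
  on the families. Two indices with the same pattern can be compared by the distance of their points.
\<close>

theorem V_distance_3_2_imp_WURP_eq:
  fixes S :: "'s gorder"
  assumes S: "upper_semilattice S" "weak_partial_order_bottom S"
    and V: "V_distance_3_2 S Y \<delta>" and gen: "range_join_generates S Y \<delta>"
  shows "WURP_eq S"
  unfolding WURP_eq_def
proof
  interpret upper_semilattice S by fact
  interpret weak_partial_order_bottom S by fact
  have d_closed [simp]: "\<delta> x y \<in> carrier S" if "x \<in> Y" "y \<in> Y" for x y
    using V that by (auto simp: V_distance_3_2_def S_valued_distance_def)
  have d_sym: "\<delta> x y = \<delta> y x" if "x \<in> Y" "y \<in> Y" for x y
    using V that by (auto simp: V_distance_3_2_def S_valued_distance_def)
  have d_tri: "\<delta> x y \<sqsubseteq>\<^bsub>S\<^esub> t" if "x \<in> Y" "y \<in> Y" "z \<in> Y" "\<delta> x z \<sqsubseteq>\<^bsub>S\<^esub> t" "\<delta> z y \<sqsubseteq>\<^bsub>S\<^esub> t" "t \<in> carrier S"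
    for x y z t
  proof (rule le_trans)
    show "\<delta> x y \<sqsubseteq>\<^bsub>S\<^esub> \<delta> x z \<squnion>\<^bsub>S\<^esub> \<delta> z y"
      using V that by (auto simp: V_distance_3_2_def S_valued_distance_def)
    show "\<delta> x z \<squnion>\<^bsub>S\<^esub> \<delta> z y \<sqsubseteq>\<^bsub>S\<^esub> t" using that by (intro join_le) auto
  qed (use that in auto)
  have le_join: "s \<sqsubseteq>\<^bsub>S\<^esub> p \<squnion>\<^bsub>S\<^esub> q" if "s \<sqsubseteq>\<^bsub>S\<^esub> p \<or> s \<sqsubseteq>\<^bsub>S\<^esub> q" "s \<in> carrier S" "p \<in> carrier S" "q \<in> carrier S"
    for s p q
    using that by (meson join_closed join_left join_right le_trans)
  fix e assume e: "e \<in> carrier S"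
  obtain T where T: "finite T" "T \<subseteq> {\<delta> x y |x y. x \<in> Y \<and> y \<in> Y}" "e = \<Squnion>\<^bsub>S\<^esub>T"
    using gen e unfolding range_join_generates_def by blast
  have "T \<subseteq> (\<lambda>(x, y). \<delta> x y) ` (Y \<times> Y)" using T(2) by auto
  then obtain P where P: "P \<subseteq> Y \<times> Y" "finite P" "T = (\<lambda>(x, y). \<delta> x y) ` P"
    using T(1) by (meson finite_subset_image)
  have "T \<subseteq> carrier S" using T(2) by auto
  then have e_lub: "is_lub S e T" using finite_sup_is_lub[OF S T(1)] T(3) by simp
  have e_ge: "\<delta> x y \<sqsubseteq>\<^bsub>S\<^esub> e" if "(x, y) \<in> P" for x y
    using least_Upper_above[OF e_lub _ \<open>T \<subseteq> carrier S\<close>] that P(3) by fastforce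
  have e_le: "e \<sqsubseteq>\<^bsub>S\<^esub> t" if "t \<in> carrier S" "\<And>x y. (x, y) \<in> P \<Longrightarrow> \<delta> x y \<sqsubseteq>\<^bsub>S\<^esub> t" for t
    using that \<open>T \<subseteq> carrier S\<close> P(3) by (intro least_le[OF e_lub] Upper_memI) auto
  obtain enum where enum: "bij_betw enum {..<card (Pow P)} (Pow P)"
    using ex_bij_betw_nat_finite[of "Pow P"] P(2) by (auto simp: atLeast0LessThan)
  define m where "m = card (Pow P)"
  have "WURP_eq_families m I S e" for I :: "('s \<times> 's) set"
    unfolding WURP_eq_families_def
  proof (intro allI impI)
    fix a b
    assume ab: "a \<in> I \<rightarrow> carrier S \<and> b \<in> I \<rightarrow> carrier S \<and> (\<forall>i\<in>I. e \<sqsubseteq>\<^bsub>S\<^esub> a i \<squnion>\<^bsub>S\<^esub> b i)"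
    then have abc [simp]: "a i \<in> carrier S" "b i \<in> carrier S" if "i \<in> I" for i using that by auto
    have "\<exists>z\<in>Y. (\<delta> x z \<sqsubseteq>\<^bsub>S\<^esub> a i \<and> \<delta> z y \<sqsubseteq>\<^bsub>S\<^esub> b i) \<or> (\<delta> x z \<sqsubseteq>\<^bsub>S\<^esub> b i \<and> \<delta> z y \<sqsubseteq>\<^bsub>S\<^esub> a i)"
      if "i \<in> I" "(x, y) \<in> P" for i x y
    proof -
      have "x \<in> Y" "y \<in> Y" using that P(1) by auto
      moreover have "\<delta> x y \<sqsubseteq>\<^bsub>S\<^esub> a i \<squnion>\<^bsub>S\<^esub> b i"
      proof (rule le_trans[OF e_ge[OF that(2)]])
        show "e \<sqsubseteq>\<^bsub>S\<^esub> a i \<squnion>\<^bsub>S\<^esub> b i" using ab that(1) by blast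
      qed (use calculation that(1) e in simp_all)
      ultimately show ?thesis
        using V abc[OF that(1)] unfolding V_distance_3_2_def by blast
    qed
    then obtain z where z: "\<And>i x y. i \<in> I \<Longrightarrow> (x, y) \<in> P \<Longrightarrow> z i x y \<in> Y \<and>
        ((\<delta> x (z i x y) \<sqsubseteq>\<^bsub>S\<^esub> a i \<and> \<delta> (z i x y) y \<sqsubseteq>\<^bsub>S\<^esub> b i) \<or>
         (\<delta> x (z i x y) \<sqsubseteq>\<^bsub>S\<^esub> b i \<and> \<delta> (z i x y) y \<sqsubseteq>\<^bsub>S\<^esub> a i))"
      by metis
    have zY: "z i x y \<in> Y" if "i \<in> I" "(x, y) \<in> P" for i x y using z[OF that] by blast
    \<comment> \<open>The pattern of \<open>i\<close>: those pairs whose interpolating point is reached through \<open>a i\<close> first.\<close>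
    define kind where "kind i = {(x, y) \<in> P. \<delta> x (z i x y) \<sqsubseteq>\<^bsub>S\<^esub> a i \<and> \<delta> (z i x y) y \<sqsubseteq>\<^bsub>S\<^esub> b i}" for i
    define J where "J u = {i \<in> I. kind i = enum u}" for u
    define C where "C i j = (\<lambda>(x, y). \<delta> (z i x y) (z j x y)) ` P" for i j
    define c where "c i j = \<Squnion>\<^bsub>S\<^esub>(C i j)" for i j
    have C: "C i j \<subseteq> carrier S" "finite (C i j)" if "i \<in> I" "j \<in> I" for i j
      using zY[OF that(1)] zY[OF that(2)] P(2) unfolding C_def by auto
    have c_lub: "is_lub S (c i j) (C i j)" if "i \<in> I" "j \<in> I" for i j
      unfolding c_def using C[OF that] by (intro finite_sup_is_lub S)
    have c_closed [simp]: "c i j \<in> carrier S" if "i \<in> I" "j \<in> I" for i j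
      using c_lub[OF that] by auto
    have c_ge: "\<delta> (z i x y) (z j x y) \<sqsubseteq>\<^bsub>S\<^esub> c i j" if "i \<in> I" "j \<in> I" "(x, y) \<in> P" for i j x y
      using least_Upper_above[OF c_lub[OF that(1,2)] _ C(1)[OF that(1,2)]] that(3)
      unfolding C_def by fastforce
    have c_le: "c i j \<sqsubseteq>\<^bsub>S\<^esub> t"
      if "i \<in> I" "j \<in> I" "t \<in> carrier S" "\<And>x y. (x, y) \<in> P \<Longrightarrow> \<delta> (z i x y) (z j x y) \<sqsubseteq>\<^bsub>S\<^esub> t" for i j t
    proof (rule least_le[OF c_lub[OF that(1,2)]], rule Upper_memI)
      show "\<And>s. s \<in> C i j \<Longrightarrow> s \<sqsubseteq>\<^bsub>S\<^esub> t" using that(4) unfolding C_def by auto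
    qed (use that C in auto)
    have J_cases: "(\<delta> x (z i x y) \<sqsubseteq>\<^bsub>S\<^esub> a i \<and> \<delta> (z i x y) y \<sqsubseteq>\<^bsub>S\<^esub> b i \<and>
          \<delta> x (z j x y) \<sqsubseteq>\<^bsub>S\<^esub> a j \<and> \<delta> (z j x y) y \<sqsubseteq>\<^bsub>S\<^esub> b j) \<or>
         (\<delta> x (z i x y) \<sqsubseteq>\<^bsub>S\<^esub> b i \<and> \<delta> (z i x y) y \<sqsubseteq>\<^bsub>S\<^esub> a i \<and>
          \<delta> x (z j x y) \<sqsubseteq>\<^bsub>S\<^esub> b j \<and> \<delta> (z j x y) y \<sqsubseteq>\<^bsub>S\<^esub> a j)"
      if "i \<in> J u" "j \<in> J u" "(x, y) \<in> P" for i j u x y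
    proof -
      have ij: "i \<in> I" "j \<in> I" and "kind i = kind j" using that by (auto simp: J_def)
      then have "(x, y) \<in> kind i \<longleftrightarrow> (x, y) \<in> kind j" by simp
      then show ?thesis
        using z[OF ij(1) that(3)] z[OF ij(2) that(3)] that(3) unfolding kind_def by auto
    qed
    have cover: "(\<Union>u<m. J u) = I"
    proof -
      have "\<exists>u<m. kind i = enum u" for i
      proof -
        have "kind i \<in> enum ` {..<m}"
          using bij_betw_imp_surj_on[OF enum] unfolding m_def kind_def by auto
        then show ?thesis by blast
      qed
      then show ?thesis unfolding J_def by blast
    qed
    have below: "c i j \<sqsubseteq>\<^bsub>S\<^esub> a i \<squnion>\<^bsub>S\<^esub> a j \<and> c i j \<sqsubseteq>\<^bsub>S\<^esub> b i \<squnion>\<^bsub>S\<^esub> b j"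
      if "i \<in> J u" "j \<in> J u" for u i j
    proof -
      have ij: "i \<in> I" "j \<in> I" using that by (auto simp: J_def)
      have main: "\<delta> (z i x y) (z j x y) \<sqsubseteq>\<^bsub>S\<^esub> a i \<squnion>\<^bsub>S\<^esub> a j \<and> \<delta> (z i x y) (z j x y) \<sqsubseteq>\<^bsub>S\<^esub> b i \<squnion>\<^bsub>S\<^esub> b j"
        if xy: "(x, y) \<in> P" for x y
      proof -
        have Y: "x \<in> Y" "y \<in> Y" "z i x y \<in> Y" "z j x y \<in> Y"
          using xy P(1) zY[OF ij(1) xy] zY[OF ij(2) xy] by auto
        have via_x: "\<delta> (z i x y) (z j x y) \<sqsubseteq>\<^bsub>S\<^esub> p \<squnion>\<^bsub>S\<^esub> q"
          if "\<delta> x (z i x y) \<sqsubseteq>\<^bsub>S\<^esub> p" "\<delta> x (z j x y) \<sqsubseteq>\<^bsub>S\<^esub> q" "p \<in> carrier S" "q \<in> carrier S" for p q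
          using that Y d_sym[OF Y(1,3)] by (intro d_tri[OF Y(3,4,1)] le_join join_closed) simp_all
        have via_y: "\<delta> (z i x y) (z j x y) \<sqsubseteq>\<^bsub>S\<^esub> p \<squnion>\<^bsub>S\<^esub> q"
          if "\<delta> (z i x y) y \<sqsubseteq>\<^bsub>S\<^esub> p" "\<delta> (z j x y) y \<sqsubseteq>\<^bsub>S\<^esub> q" "p \<in> carrier S" "q \<in> carrier S" for p q
          using that Y d_sym[OF Y(4,2)] by (intro d_tri[OF Y(3,4,2)] le_join join_closed) simp_all
        show ?thesis using J_cases[OF \<open>i \<in> J u\<close> \<open>j \<in> J u\<close> xy] via_x via_y
            abc[OF ij(1)] abc[OF ij(2)] by metis
      qed
      show ?thesis using main by (intro conjI c_le) (simp_all add: ij)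
    qed
    have cut: "e \<sqsubseteq>\<^bsub>S\<^esub> a j \<squnion>\<^bsub>S\<^esub> b i \<squnion>\<^bsub>S\<^esub> c i j" if "i \<in> J u" "j \<in> J u" for u i j
    proof -
      have ij: "i \<in> I" "j \<in> I" using that by (auto simp: J_def)
      let ?t = "a j \<squnion>\<^bsub>S\<^esub> b i \<squnion>\<^bsub>S\<^esub> c i j"
      have below: "s \<sqsubseteq>\<^bsub>S\<^esub> ?t" if "s \<sqsubseteq>\<^bsub>S\<^esub> a j \<or> s \<sqsubseteq>\<^bsub>S\<^esub> b i \<or> s \<sqsubseteq>\<^bsub>S\<^esub> c i j" "s \<in> carrier S" for s
        using that ij by (meson le_join join_closed abc c_closed)
      have t: "?t \<in> carrier S" using ij by simp
      show ?thesis
      proof (rule e_le)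
        fix x y assume xy: "(x, y) \<in> P"
        have Y: "x \<in> Y" "y \<in> Y" "z i x y \<in> Y" "z j x y \<in> Y"
          using xy P(1) zY[OF ij(1) xy] zY[OF ij(2) xy] by auto
        have zz: "\<delta> (z i x y) (z j x y) \<sqsubseteq>\<^bsub>S\<^esub> ?t" "\<delta> (z j x y) (z i x y) \<sqsubseteq>\<^bsub>S\<^esub> ?t"
          using c_ge[OF ij xy] Y d_sym[OF Y(3,4)] by (simp_all add: below)
        \<comment> \<open>Walk from \<open>x\<close> to \<open>y\<close> via the points of \<open>i\<close> and \<open>j\<close>, entering and leaving on the sides
          that belong to \<open>a j\<close> and \<open>b i\<close>; the pattern decides which of the two points comes first.\<close>
        from J_cases[OF that xy] show "\<delta> x y \<sqsubseteq>\<^bsub>S\<^esub> ?t"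
        proof (elim disjE conjE)
          assume "\<delta> x (z j x y) \<sqsubseteq>\<^bsub>S\<^esub> a j" "\<delta> (z i x y) y \<sqsubseteq>\<^bsub>S\<^esub> b i"
          then have "\<delta> x (z j x y) \<sqsubseteq>\<^bsub>S\<^esub> ?t" "\<delta> (z i x y) y \<sqsubseteq>\<^bsub>S\<^esub> ?t" using Y by (simp_all add: below)
          then show ?thesis
            using zz t by (intro d_tri[OF Y(1,2,4)] d_tri[OF Y(4,2,3)])
        next
          assume "\<delta> x (z i x y) \<sqsubseteq>\<^bsub>S\<^esub> b i" "\<delta> (z j x y) y \<sqsubseteq>\<^bsub>S\<^esub> a j"
          then have "\<delta> x (z i x y) \<sqsubseteq>\<^bsub>S\<^esub> ?t" "\<delta> (z j x y) y \<sqsubseteq>\<^bsub>S\<^esub> ?t" using Y by (simp_all add: below)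
          then show ?thesis
            using zz t by (intro d_tri[OF Y(1,2,3)] d_tri[OF Y(3,2,4)])
        qed
      qed (use ij in simp_all)
    qed
    have tri: "c i k \<sqsubseteq>\<^bsub>S\<^esub> c i j \<squnion>\<^bsub>S\<^esub> c j k" if "i \<in> I" "j \<in> I" "k \<in> I" for i j k
    proof (rule c_le)
      fix x y assume xy: "(x, y) \<in> P"
      have Y: "z i x y \<in> Y" "z j x y \<in> Y" "z k x y \<in> Y" by (rule zY[OF _ xy], fact)+
      then show "\<delta> (z i x y) (z k x y) \<sqsubseteq>\<^bsub>S\<^esub> c i j \<squnion>\<^bsub>S\<^esub> c j k"
        using c_ge[OF that(1,2) xy] c_ge[OF that(2,3) xy] that
        by (intro d_tri[OF Y(1,3,2)] le_join join_closed) simp_all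
    qed (use that in simp_all)
    show "\<exists>(J :: nat \<Rightarrow> ('s \<times> 's) set) c.
          (\<Union>u<m. J u) = I \<and>
          (\<forall>i\<in>I. \<forall>j\<in>I. c i j \<in> carrier S) \<and>
          (\<forall>u<m. \<forall>i\<in>J u. \<forall>j\<in>J u. c i j \<sqsubseteq>\<^bsub>S\<^esub> a i \<squnion>\<^bsub>S\<^esub> a j \<and> c i j \<sqsubseteq>\<^bsub>S\<^esub> b i \<squnion>\<^bsub>S\<^esub> b j) \<and>
          (\<forall>u<m. \<forall>i\<in>J u. \<forall>j\<in>J u. e \<sqsubseteq>\<^bsub>S\<^esub> a j \<squnion>\<^bsub>S\<^esub> b i \<squnion>\<^bsub>S\<^esub> c i j) \<and>
          (\<forall>i\<in>I. \<forall>j\<in>I. \<forall>k\<in>I. c i k \<sqsubseteq>\<^bsub>S\<^esub> c i j \<squnion>\<^bsub>S\<^esub> c j k)"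
      by (intro exI[of _ J] exI[of _ c] conjI ballI allI impI)
        (fact cover | erule (1) c_closed | erule (1) below[THEN conjunct1] | erule (1) below[THEN conjunct2]
          | erule (1) cut | erule (2) tri)+
  qed
  moreover have "m > 0" unfolding m_def using P(2) by (simp add: card_Pow)
  ultimately show "WURP_eq_at S e" unfolding WURP_eq_at_def by blast
qed

section \<open>Congruences and compact congruences\<close>

lemma partial_order_inclusion: "partial_order \<lparr>carrier = C, eq = (=), le = (\<subseteq>)\<rparr>"
  by unfold_locales auto

lemma is_lub_inclusion:
  "is_lub \<lparr>carrier = C, eq = (=), le = (\<subseteq>)\<rparr> s A \<longleftrightarrow>
     s \<in> C \<and> (\<forall>a\<in>A \<inter> C. a \<subseteq> s) \<and> (\<forall>t\<in>C. (\<forall>a\<in>A \<inter> C. a \<subseteq> t) \<longrightarrow> s \<subseteq> t)"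
  unfolding least_def Upper_def by (simp add: Ball_def) blast

lemma congruencesD:
  assumes "\<theta> \<in> congruences A"
  shows "\<theta> \<subseteq> carrier A \<times> carrier A" "refl_on (carrier A) \<theta>" "sym \<theta>" "trans \<theta>"
    "f \<in> symbols A \<Longrightarrow> length xs = arity A f \<Longrightarrow> list_all2 (\<lambda>x y. (x, y) \<in> \<theta>) xs ys
      \<Longrightarrow> (interp A f xs, interp A f ys) \<in> \<theta>"
  using assms by (auto simp: congruences_def equiv_def refl_on_def)

lemma full_congruence: "is_algebra A \<Longrightarrow> carrier A \<times> carrier A \<in> congruences A"
proof -
  assume A: "is_algebra A"
  have "set xs \<subseteq> carrier A \<and> set ys \<subseteq> carrier A \<and> length xs = length ys"
    if "list_all2 (\<lambda>x y. (x, y) \<in> carrier A \<times> carrier A) xs ys" for xs ys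
    using that by (auto simp: list_all2_conv_all_nth in_set_conv_nth)
  then show ?thesis
    using A unfolding congruences_def is_algebra_def
    by (auto simp: equiv_def refl_on_def sym_def trans_def)
qed

lemma Inter_congruence:
  assumes "\<Theta> \<subseteq> congruences A" "\<Theta> \<noteq> {}"
  shows "\<Inter>\<Theta> \<in> congruences A"
proof -
  have "equiv (carrier A) (\<Inter>\<Theta>)"
  proof (rule equivI)
    show "\<Inter>\<Theta> \<subseteq> carrier A \<times> carrier A" using assms congruencesD(1) by blast
    show "refl_on (carrier A) (\<Inter>\<Theta>)"
      using assms congruencesD(2) unfolding refl_on_def by blast
    show "sym (\<Inter>\<Theta>)" using assms congruencesD(3) unfolding sym_def by blast
    show "trans (\<Inter>\<Theta>)" using assms congruencesD(4) unfolding trans_def by blast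
  qed
  moreover have "(interp A f xs, interp A f ys) \<in> \<Inter>\<Theta>"
    if "f \<in> symbols A" "length xs = arity A f" "list_all2 (\<lambda>x y. (x, y) \<in> \<Inter>\<Theta>) xs ys" for f xs ys
  proof
    fix \<theta> assume \<theta>: "\<theta> \<in> \<Theta>"
    have "list_all2 (\<lambda>x y. (x, y) \<in> \<theta>) xs ys"
      by (rule list_all2_mono[OF that(3)]) (use \<theta> in blast)
    then show "(interp A f xs, interp A f ys) \<in> \<theta>"
      using congruencesD(5)[OF subsetD[OF assms(1) \<theta>]] that(1,2) by blast
  qed
  ultimately show ?thesis unfolding congruences_def by blast
qed

text \<open>Both parts hold because operations are finitary: finitely many pairs in the union of a directed family
  already lie in one member.\<close>

lemma directed_Union_congruence:
  assumes D: "D \<subseteq> congruences A" "D \<noteq> {}"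
    and dir: "\<And>\<alpha> \<beta>. \<alpha> \<in> D \<Longrightarrow> \<beta> \<in> D \<Longrightarrow> \<exists>\<gamma>\<in>D. \<alpha> \<subseteq> \<gamma> \<and> \<beta> \<subseteq> \<gamma>"
  shows "\<Union>D \<in> congruences A"
    and "finite R \<Longrightarrow> R \<subseteq> \<Union>D \<Longrightarrow> \<exists>\<gamma>\<in>D. R \<subseteq> \<gamma>"
proof -
  show absorb: "\<exists>\<gamma>\<in>D. R \<subseteq> \<gamma>" if "finite R" "R \<subseteq> \<Union>D" for R
    using that
  proof (induction R rule: finite_induct)
    case empty
    then show ?case using D(2) by auto
  next
    case (insert p R)
    then obtain \<alpha> \<beta> where "\<alpha> \<in> D" "R \<subseteq> \<alpha>" "\<beta> \<in> D" "p \<in> \<beta>" by auto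
    with dir[of \<alpha> \<beta>] show ?case by blast
  qed
  have "equiv (carrier A) (\<Union>D)"
  proof (rule equivI)
    show "\<Union>D \<subseteq> carrier A \<times> carrier A" using D congruencesD(1) by blast
    show "refl_on (carrier A) (\<Union>D)" using D congruencesD(2) unfolding refl_on_def by blast
    show "sym (\<Union>D)" using D congruencesD(3) unfolding sym_def by blast
    show "trans (\<Union>D)"
    proof (rule transI)
      fix x y z assume "(x, y) \<in> \<Union>D" "(y, z) \<in> \<Union>D"
      then obtain \<gamma> where \<gamma>: "\<gamma> \<in> D" "{(x, y), (y, z)} \<subseteq> \<gamma>" using absorb[of "{(x, y), (y, z)}"] by auto
      then have "(x, z) \<in> \<gamma>"
        using transD[OF congruencesD(4)[OF subsetD[OF D(1) \<gamma>(1)]], of x y z] by simp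
      then show "(x, z) \<in> \<Union>D" using \<gamma>(1) by blast
    qed
  qed
  moreover have "(interp A f xs, interp A f ys) \<in> \<Union>D"
    if "f \<in> symbols A" "length xs = arity A f" "list_all2 (\<lambda>x y. (x, y) \<in> \<Union>D) xs ys" for f xs ys
  proof -
    have "set (zip xs ys) \<subseteq> \<Union>D" using that(3) by (auto simp: list_all2_iff)
    then obtain \<gamma> where \<gamma>: "\<gamma> \<in> D" "set (zip xs ys) \<subseteq> \<gamma>" using absorb by blast
    then have "list_all2 (\<lambda>x y. (x, y) \<in> \<gamma>) xs ys" using that(3) by (auto simp: list_all2_iff)
    then have "(interp A f xs, interp A f ys) \<in> \<gamma>"
      by (rule congruencesD(5)[OF subsetD[OF D(1) \<gamma>(1)] that(1,2)])
    then show ?thesis using \<gamma>(1) by blast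
  qed
  ultimately show "\<Union>D \<in> congruences A" unfolding congruences_def by blast
qed

lemma congruence_generated:
  assumes "is_algebra A" "R \<subseteq> carrier A \<times> carrier A"
  shows "congruence_generated A R \<in> congruences A" "R \<subseteq> congruence_generated A R"
    and "\<theta> \<in> congruences A \<Longrightarrow> congruence_generated A R \<subseteq> \<theta> \<longleftrightarrow> R \<subseteq> \<theta>"
proof -
  have "{\<theta> \<in> congruences A. R \<subseteq> \<theta>} \<noteq> {}" using full_congruence assms by blast
  then show "congruence_generated A R \<in> congruences A"
    unfolding congruence_generated_def by (intro Inter_congruence) auto
  show R: "R \<subseteq> congruence_generated A R" unfolding congruence_generated_def by auto
  show "congruence_generated A R \<subseteq> \<theta> \<longleftrightarrow> R \<subseteq> \<theta>" if "\<theta> \<in> congruences A"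
    using that R unfolding congruence_generated_def by auto
qed

lemma Con_c_closed:
  assumes "is_algebra A"
  shows "carrier (Con_c A) \<subseteq> congruences A"
  using congruence_generated(1)[OF assms] by (auto simp: Con_c_def)

lemma congruence_generated_Un_lub:
  assumes A: "is_algebra A" and R: "R \<subseteq> carrier A \<times> carrier A" and R': "R' \<subseteq> carrier A \<times> carrier A"
    and \<theta>: "\<theta> \<in> congruences A"
  shows "congruence_generated A (R \<union> R') \<subseteq> \<theta> \<longleftrightarrow>
    congruence_generated A R \<subseteq> \<theta> \<and> congruence_generated A R' \<subseteq> \<theta>"
  using congruence_generated(3)[OF A _ \<theta>] R R' by simp

text \<open>The union of two finite generating sets generates the join. Hence the universal property extends to
  congruences \<open>\<theta>\<close> that need not be compact, which allows kernels as upper bounds.\<close>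

lemma Con_c_join_exists:
  assumes A: "is_algebra A" and "\<alpha> \<in> carrier (Con_c A)" "\<beta> \<in> carrier (Con_c A)"
  obtains \<gamma> where "is_lub (Con_c A) \<gamma> {\<alpha>, \<beta>}" "\<alpha> \<squnion>\<^bsub>Con_c A\<^esub> \<beta> = \<gamma>"
    "\<And>\<theta>. \<theta> \<in> congruences A \<Longrightarrow> \<gamma> \<subseteq> \<theta> \<longleftrightarrow> \<alpha> \<subseteq> \<theta> \<and> \<beta> \<subseteq> \<theta>"
proof -
  obtain R R' where R: "\<alpha> = congruence_generated A R" "finite R" "R \<subseteq> carrier A \<times> carrier A"
      "\<beta> = congruence_generated A R'" "finite R'" "R' \<subseteq> carrier A \<times> carrier A"
    using assms(2,3) by (auto simp: Con_c_def)
  let ?\<gamma> = "congruence_generated A (R \<union> R')"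
  have *: "?\<gamma> \<subseteq> \<theta> \<longleftrightarrow> \<alpha> \<subseteq> \<theta> \<and> \<beta> \<subseteq> \<theta>" if "\<theta> \<in> congruences A" for \<theta>
    using congruence_generated_Un_lub[OF A R(3,6) that] R(1,4) by simp
  have in_c: "?\<gamma> \<in> carrier (Con_c A)" unfolding Con_c_def using R by auto
  have "is_lub (Con_c A) ?\<gamma> {\<alpha>, \<beta>}"
    unfolding Con_c_def is_lub_inclusion
    using in_c *[OF subsetD[OF Con_c_closed[OF A]]] assms(2,3) by (auto simp: Con_c_def)
  moreover from this have "\<alpha> \<squnion>\<^bsub>Con_c A\<^esub> \<beta> = ?\<gamma>"
    unfolding Con_c_def by (intro join_eq_lub partial_order_inclusion)
  ultimately show thesis using that * by blast
qed

lemma Con_c_join_subset_iff: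
  assumes "is_algebra A" "\<alpha> \<in> carrier (Con_c A)" "\<beta> \<in> carrier (Con_c A)" "\<theta> \<in> congruences A"
  shows "\<alpha> \<squnion>\<^bsub>Con_c A\<^esub> \<beta> \<subseteq> \<theta> \<longleftrightarrow> \<alpha> \<subseteq> \<theta> \<and> \<beta> \<subseteq> \<theta>"
  using Con_c_join_exists[OF assms(1-3)] assms(4) by metis

lemma Con_c_bottom:
  assumes A: "is_algebra A"
  shows "least (Con_c A) (congruence_generated A {}) (carrier (Con_c A))"
proof -
  have "congruence_generated A {} \<in> carrier (Con_c A)" by (auto simp: Con_c_def)
  moreover have "congruence_generated A {} \<subseteq> \<theta>" if "\<theta> \<in> carrier (Con_c A)" for \<theta>
    using congruence_generated(3)[OF A, of "{}" \<theta>] Con_c_closed[OF A] that by blast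
  ultimately show ?thesis unfolding least_def by (simp add: Con_c_def)
qed

lemma Con_c_semilattice:
  assumes A: "is_algebra A"
  shows "upper_semilattice (Con_c A)" "weak_partial_order_bottom (Con_c A)"
proof -
  have po: "partial_order (Con_c A)" unfolding Con_c_def by (rule partial_order_inclusion)
  interpret partial_order "Con_c A" by fact
  show "upper_semilattice (Con_c A)"
  proof
    fix x y assume "x \<in> carrier (Con_c A)" "y \<in> carrier (Con_c A)"
    then show "\<exists>s. is_lub (Con_c A) s {x, y}" by (rule Con_c_join_exists[OF A]) blast
  qed
  show "weak_partial_order_bottom (Con_c A)"
    by unfold_locales (use Con_c_bottom[OF A] in blast)
qed

lemma lattice_algebra_is_algebra:
  assumes "lattice L"
  shows "is_algebra (lattice_algebra L)"
proof -
  interpret lattice L by fact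
  have "interp (lattice_algebra L) f xs \<in> carrier L"
    if "set xs \<subseteq> carrier L" "length xs = 2" for f xs
  proof -
    have "xs ! 0 \<in> carrier L" "xs ! 1 \<in> carrier L" using that nth_mem[of _ xs] by auto
    then show ?thesis by (cases f) (simp_all add: lattice_algebra_def)
  qed
  then show ?thesis unfolding is_algebra_def by (simp add: lattice_algebra_def)
qed

definition kernel :: "'a gorder \<Rightarrow> ('a \<Rightarrow> 'b) \<Rightarrow> ('a \<times> 'a) set" where
  "kernel L g = {(s, t) \<in> carrier L \<times> carrier L. g s = g t}"

lemma kernel_congruence:
  assumes g: "lattice_hom L M g"
  shows "kernel L g \<in> congruences (lattice_algebra L)"
proof -
  interpret lattice L using g unfolding lattice_hom_def join_pres_def by blast
  have "equiv (carrier L) (kernel L g)"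
    by (rule equivI) (auto simp: kernel_def refl_on_def sym_def trans_def)
  moreover have "(interp (lattice_algebra L) f xs, interp (lattice_algebra L) f ys) \<in> kernel L g"
    if "length xs = 2" "list_all2 (\<lambda>x y. (x, y) \<in> kernel L g) xs ys" for f xs ys
  proof -
    have "(xs ! 0, ys ! 0) \<in> kernel L g" "(xs ! 1, ys ! 1) \<in> kernel L g"
      using that by (auto simp: list_all2_conv_all_nth)
    then show ?thesis
      using g unfolding lattice_hom_def join_pres_def meet_pres_def
      by (cases f) (simp_all add: kernel_def lattice_algebra_def)
  qed
  ultimately show ?thesis unfolding congruences_def by (simp add: lattice_algebra_def)
qed

section \<open>Distances from almost permutable congruences\<close>

text \<open>
  Being finitely generated is an order-theoretic property. The congruence \<open>\<phi> \<theta>\<close> is the directed union of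
  its finitely generated subcongruences. Pulling these back gives a directed family whose union is a
  congruence and contains \<open>\<theta>\<close>; since \<open>\<theta>\<close> is finitely generated, one member already equals \<open>\<theta>\<close>.
\<close>

lemma order_iso_preserves_compact:
  assumes A: "is_algebra A" and B: "is_algebra B"
    and bij: "bij_betw \<phi> (congruences A) (congruences B)"
    and ord: "\<And>\<theta> \<psi>. \<theta> \<in> congruences A \<Longrightarrow> \<psi> \<in> congruences A \<Longrightarrow> \<phi> \<theta> \<subseteq> \<phi> \<psi> \<longleftrightarrow> \<theta> \<subseteq> \<psi>"
    and \<theta>: "\<theta> \<in> carrier (Con_c A)"
  shows "\<phi> \<theta> \<in> carrier (Con_c B)"
proof -
  have \<theta>A: "\<theta> \<in> congruences A" using Con_c_closed[OF A] \<theta> by blast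
  then have \<phi>\<theta>: "\<phi> \<theta> \<in> congruences B" using bij bij_betwE by blast
  then have sub: "\<phi> \<theta> \<subseteq> carrier B \<times> carrier B" by (rule congruencesD)
  obtain R where R: "finite R" "R \<subseteq> carrier A \<times> carrier A" "\<theta> = congruence_generated A R"
    using \<theta> unfolding Con_c_def by auto
  define D where "D = {\<psi> \<in> congruences A. \<exists>Q. finite Q \<and> Q \<subseteq> \<phi> \<theta> \<and> \<phi> \<psi> = congruence_generated B Q}"
  have pre: "\<exists>\<psi>\<in>D. \<phi> \<psi> = congruence_generated B Q" if "finite Q" "Q \<subseteq> \<phi> \<theta>" for Q
  proof -
    have "congruence_generated B Q \<in> \<phi> ` congruences A"
      using bij sub that congruence_generated(1)[OF B, of Q] by (auto simp: bij_betw_def)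
    then show ?thesis using that unfolding D_def by auto
  qed
  have DA: "D \<subseteq> congruences A" unfolding D_def by auto
  have ne: "D \<noteq> {}" using pre[of "{}"] by auto
  have dir: "\<exists>\<gamma>\<in>D. \<alpha> \<subseteq> \<gamma> \<and> \<beta> \<subseteq> \<gamma>" if \<alpha>: "\<alpha> \<in> D" and \<beta>: "\<beta> \<in> D" for \<alpha> \<beta>
  proof -
    obtain Q where Q: "finite Q" "Q \<subseteq> \<phi> \<theta>" "\<phi> \<alpha> = congruence_generated B Q"
      using \<alpha> unfolding D_def by blast
    obtain Q' where Q': "finite Q'" "Q' \<subseteq> \<phi> \<theta>" "\<phi> \<beta> = congruence_generated B Q'"
      using \<beta> unfolding D_def by blast
    obtain \<gamma> where \<gamma>: "\<gamma> \<in> D" "\<phi> \<gamma> = congruence_generated B (Q \<union> Q')" using pre[of "Q \<union> Q'"] Q Q' by blast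
    have QB: "Q \<subseteq> carrier B \<times> carrier B" "Q' \<subseteq> carrier B \<times> carrier B"
      using Q(2) Q'(2) sub by auto
    then have "congruence_generated B (Q \<union> Q') \<in> congruences B"
      by (intro congruence_generated(1)[OF B]) simp
    then have "\<phi> \<alpha> \<subseteq> \<phi> \<gamma> \<and> \<phi> \<beta> \<subseteq> \<phi> \<gamma>"
      using congruence_generated_Un_lub[OF B QB, of "\<phi> \<gamma>"] unfolding Q(3) Q'(3) \<gamma>(2) by simp
    then have "\<alpha> \<subseteq> \<gamma> \<and> \<beta> \<subseteq> \<gamma>"
      using ord[of \<alpha> \<gamma>] ord[of \<beta> \<gamma>] DA \<alpha> \<beta> \<gamma>(1) by (simp add: subset_iff)
    then show ?thesis using \<gamma>(1) by (rule bexI)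
  qed
  note U = directed_Union_congruence[OF DA ne dir]
  have "\<phi> \<theta> \<subseteq> \<phi> (\<Union>D)"
  proof
    fix p assume p: "p \<in> \<phi> \<theta>"
    then obtain \<psi> where \<psi>: "\<psi> \<in> D" "\<phi> \<psi> = congruence_generated B {p}" using pre[of "{p}"] by auto
    then have "p \<in> \<phi> \<psi>" using congruence_generated(2)[OF B, of "{p}"] p sub by auto
    moreover have "\<phi> \<psi> \<subseteq> \<phi> (\<Union>D)" 
      using ord[OF subsetD[OF DA \<psi>(1)] U(1)] Union_upper[OF \<psi>(1)] by simp
    ultimately show "p \<in> \<phi> (\<Union>D)" by blast
  qed
  then have "R \<subseteq> \<Union>D" using ord[OF \<theta>A U(1)] R congruence_generated(2)[OF A R(2)] by auto
  then obtain \<psi> where \<psi>: "\<psi> \<in> D" "R \<subseteq> \<psi>" using U(2) R(1) by blast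
  then have "\<theta> \<subseteq> \<psi>" using congruence_generated(3)[OF A R(2) subsetD[OF DA \<psi>(1)]] R(3) by simp
  then have "\<phi> \<theta> \<subseteq> \<phi> \<psi>" using ord[OF \<theta>A subsetD[OF DA \<psi>(1)]] by simp
  moreover obtain Q where Q: "finite Q" "Q \<subseteq> \<phi> \<theta>" "\<phi> \<psi> = congruence_generated B Q"
    using \<psi>(1) unfolding D_def by auto
  moreover have "congruence_generated B Q \<subseteq> \<phi> \<theta>"
    using congruence_generated(3)[OF B _ \<phi>\<theta>, of Q] Q sub by auto
  ultimately have "\<phi> \<theta> = congruence_generated B Q" by simp
  moreover have "Q \<subseteq> carrier B \<times> carrier B" using Q(2) sub by (rule subset_trans)
  ultimately show ?thesis using Q(1) unfolding Con_c_def by auto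
qed

text \<open>
  For an isomorphism \<open>\<phi>\<close> from \<open>Con B\<close> to \<open>Con A\<close>, let \<open>\<delta> x y\<close> be the preimage of the principal congruence
  generated by \<open>(x, y)\<close>. Everything follows from the adjunction \<open>\<delta> x y \<subseteq> \<theta> \<longleftrightarrow> (x, y) \<in> \<phi> \<theta>\<close>; in
  particular, almost permutability of \<open>\<phi> a\<close> and \<open>\<phi> b\<close> is literally the interpolation property of \<open>\<delta>\<close>.
\<close>

theorem almost_permutable_gives_V_distance:
  assumes B: "is_algebra B" and A: "is_algebra A" and ap: "almost_permutable_congruences A"
    and iso: "lattice_isomorphic (Con B) (Con A)"
  obtains \<delta> where "V_distance_3_2 (Con_c B) (carrier A) \<delta>"
    "range_join_generates (Con_c B) (carrier A) \<delta>"
proof -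
  obtain \<phi> where hom: "lattice_hom (Con B) (Con A) \<phi>"
    and bij0: "bij_betw \<phi> (carrier (Con B)) (carrier (Con A))"
    using iso unfolding lattice_isomorphic_def by blast
  have bij: "bij_betw \<phi> (congruences B) (congruences A)" using bij0 by (simp add: Con_def)
  interpret LB: lattice "Con B" using hom unfolding lattice_hom_def join_pres_def by blast
  interpret LA: lattice "Con A" using hom unfolding lattice_hom_def join_pres_def by blast
  have carB [simp]: "carrier (Con B) = congruences B" and carA [simp]: "carrier (Con A) = congruences A"
    and leB [simp]: "le (Con B) = (\<subseteq>)" and leA [simp]: "le (Con A) = (\<subseteq>)" by (auto simp: Con_def)
  have \<phi>A: "\<phi> \<theta> \<in> congruences A" if "\<theta> \<in> congruences B" for \<theta> using bij that bij_betwE by blast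
  have \<phi>join: "\<phi> (\<theta> \<squnion>\<^bsub>Con B\<^esub> \<psi>) = \<phi> \<theta> \<squnion>\<^bsub>Con A\<^esub> \<phi> \<psi>"
    if "\<theta> \<in> congruences B" "\<psi> \<in> congruences B" for \<theta> \<psi>
    using hom that unfolding lattice_hom_def join_pres_def by auto
  have ord: "\<phi> \<theta> \<subseteq> \<phi> \<psi> \<longleftrightarrow> \<theta> \<subseteq> \<psi>" if "\<theta> \<in> congruences B" "\<psi> \<in> congruences B" for \<theta> \<psi>
  proof -
    have "\<phi> \<theta> \<subseteq> \<phi> \<psi> \<longleftrightarrow> \<phi> (\<theta> \<squnion>\<^bsub>Con B\<^esub> \<psi>) = \<phi> \<psi>"
      using LA.le_iff_meet[of "\<phi> \<theta>" "\<phi> \<psi>"] \<phi>A that \<phi>join by auto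
    also have "\<dots> \<longleftrightarrow> \<theta> \<squnion>\<^bsub>Con B\<^esub> \<psi> = \<psi>"
      using bij LB.join_closed[of \<theta> \<psi>] that unfolding bij_betw_def inj_on_def by auto
    also have "\<dots> \<longleftrightarrow> \<theta> \<subseteq> \<psi>" using LB.le_iff_meet[of \<theta> \<psi>] that by auto
    finally show ?thesis .
  qed
  define \<chi> where "\<chi> = inv_into (congruences B) \<phi>"
  have \<chi>bij: "bij_betw \<chi> (congruences A) (congruences B)"
    unfolding \<chi>_def by (rule bij_betw_inv_into[OF bij])
  have \<phi>\<chi>: "\<phi> (\<chi> \<theta>) = \<theta>" if "\<theta> \<in> congruences A" for \<theta>
    using bij that unfolding \<chi>_def by (rule bij_betw_inv_into_right)
  have \<chi>B: "\<chi> \<theta> \<in> congruences B" if "\<theta> \<in> congruences A" for \<theta> using \<chi>bij that bij_betwE by blast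
  have \<chi>ord: "\<chi> \<theta> \<subseteq> \<chi> \<psi> \<longleftrightarrow> \<theta> \<subseteq> \<psi>" if "\<theta> \<in> congruences A" "\<psi> \<in> congruences A" for \<theta> \<psi>
    using ord[of "\<chi> \<theta>" "\<chi> \<psi>"] that \<phi>\<chi> \<chi>B by simp
  define \<delta> where "\<delta> x y = \<chi> (congruence_generated A {(x, y)})" for x y
  have \<delta>_c: "\<delta> x y \<in> carrier (Con_c B)" if "x \<in> carrier A" "y \<in> carrier A" for x y
    unfolding \<delta>_def
  proof (rule order_iso_preserves_compact[OF A B \<chi>bij \<chi>ord])
    show "congruence_generated A {(x, y)} \<in> carrier (Con_c A)"
      unfolding Con_c_def using that by auto
  qed
  have \<delta>: "\<delta> x y \<subseteq> \<theta> \<longleftrightarrow> (x, y) \<in> \<phi> \<theta>" if "\<theta> \<in> congruences B" "x \<in> carrier A" "y \<in> carrier A" for x y \<theta>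
    using ord[of "\<delta> x y" \<theta>] that \<chi>B \<phi>\<chi> \<phi>A congruence_generated[OF A, of "{(x, y)}"]
    unfolding \<delta>_def by auto
  have cB: "\<theta> \<in> congruences B" if "\<theta> \<in> carrier (Con_c B)" for \<theta> using Con_c_closed[OF B] that by blast
  have le_c [simp]: "le (Con_c B) = (\<subseteq>)" by (simp add: Con_c_def)
  have po: "partial_order (Con_c B)" unfolding Con_c_def by (rule partial_order_inclusion)
  interpret C: upper_semilattice "Con_c B" by (rule Con_c_semilattice[OF B])
  have "V_distance_3_2 (Con_c B) (carrier A) \<delta>"
    unfolding V_distance_3_2_def S_valued_distance_def le_c
  proof (intro conjI ballI impI)
    fix x assume x: "x \<in> carrier A"
    have "least (Con_c B) (\<delta> x x) (carrier (Con_c B))"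
      using \<delta>_c[OF x x] \<delta>[OF cB x x] congruencesD(2)[OF \<phi>A[OF cB]] x
      unfolding least_def le_c refl_on_def by auto
    then show "\<delta> x x = \<bottom>\<^bsub>Con_c B\<^esub>" using bottom_eq_least[OF po] by simp
  next
    fix x y assume xy: "x \<in> carrier A" "y \<in> carrier A"
    show "\<delta> x y \<in> carrier (Con_c B)" by (rule \<delta>_c[OF xy])
    have le: "\<delta> x y \<subseteq> \<delta> y x" if "x \<in> carrier A" "y \<in> carrier A" for x y
      using \<delta>[OF cB[OF \<delta>_c[OF that(2,1)]]] that congruencesD(3)[OF \<phi>A[OF cB[OF \<delta>_c[OF that(2,1)]]]]
      unfolding sym_def by blast
    show "\<delta> x y = \<delta> y x" using le[OF xy] le[OF xy(2,1)] by blast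
    fix z assume z: "z \<in> carrier A"
    let ?\<theta> = "\<delta> x y \<squnion>\<^bsub>Con_c B\<^esub> \<delta> y z"
    have \<theta>: "?\<theta> \<in> carrier (Con_c B)" using xy z \<delta>_c by simp
    have "(x, y) \<in> \<phi> ?\<theta>" "(y, z) \<in> \<phi> ?\<theta>"
      using \<delta>[OF cB[OF \<theta>]] xy z C.join_left[of "\<delta> x y" "\<delta> y z"] C.join_right[of "\<delta> x y" "\<delta> y z"] \<delta>_c
      by auto
    then have "(x, z) \<in> \<phi> ?\<theta>"
      using congruencesD(4)[OF \<phi>A[OF cB[OF \<theta>]]] unfolding trans_def by blast
    then show "\<delta> x z \<subseteq> ?\<theta>" using \<delta>[OF cB[OF \<theta>] xy(1) z] by simp
  next
    fix x y a b
    assume xy: "x \<in> carrier A" "y \<in> carrier A" and ab: "a \<in> carrier (Con_c B)" "b \<in> carrier (Con_c B)"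
      and le: "\<delta> x y \<subseteq> a \<squnion>\<^bsub>Con_c B\<^esub> b"
    have aB: "a \<in> congruences B" "b \<in> congruences B" using ab cB by auto
    have jB: "a \<squnion>\<^bsub>Con B\<^esub> b \<in> congruences B" using LB.join_closed[of a b] aB by simp
    have "a \<squnion>\<^bsub>Con_c B\<^esub> b \<subseteq> a \<squnion>\<^bsub>Con B\<^esub> b"
      using Con_c_join_subset_iff[OF B ab jB] LB.join_left[of a b] LB.join_right[of a b] aB by simp
    then have "(x, y) \<in> \<phi> (a \<squnion>\<^bsub>Con B\<^esub> b)" using \<delta>[OF jB xy] le by blast
    also have "\<dots> = (\<phi> a O \<phi> b) \<union> (\<phi> b O \<phi> a)"
      using \<phi>join[OF aB] ap \<phi>A aB unfolding almost_permutable_congruences_def by auto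
    finally obtain z where "((x, z) \<in> \<phi> a \<and> (z, y) \<in> \<phi> b) \<or> ((x, z) \<in> \<phi> b \<and> (z, y) \<in> \<phi> a)" by auto
    moreover from this have z: "z \<in> carrier A" using congruencesD(1)[OF \<phi>A] aB by blast
    ultimately show "\<exists>z\<in>carrier A. (\<delta> x z \<subseteq> a \<and> \<delta> z y \<subseteq> b) \<or> (\<delta> x z \<subseteq> b \<and> \<delta> z y \<subseteq> a)"
      using \<delta> aB xy by blast
  qed
  moreover have "range_join_generates (Con_c B) (carrier A) \<delta>"
    unfolding range_join_generates_def
  proof
    fix s assume s: "s \<in> carrier (Con_c B)"
    have "\<phi> s \<in> carrier (Con_c A)" by (rule order_iso_preserves_compact[OF B A bij ord s])
    then obtain R where R: "finite R" "R \<subseteq> carrier A \<times> carrier A" "\<phi> s = congruence_generated A R"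
      unfolding Con_c_def by auto
    let ?T = "(\<lambda>(x, y). \<delta> x y) ` R"
    have T: "?T \<subseteq> carrier (Con_c B)" using R(2) \<delta>_c by auto
    have *: "(\<forall>t\<in>?T. t \<subseteq> \<theta>) \<longleftrightarrow> s \<subseteq> \<theta>" if "\<theta> \<in> carrier (Con_c B)" for \<theta>
    proof -
      have "(\<forall>t\<in>?T. t \<subseteq> \<theta>) \<longleftrightarrow> (\<forall>(x, y)\<in>R. \<delta> x y \<subseteq> \<theta>)" by auto
      also have "\<dots> \<longleftrightarrow> (\<forall>(x, y)\<in>R. (x, y) \<in> \<phi> \<theta>)"
        using \<delta>[OF cB[OF that]] R(2) by (intro ball_cong) auto
      also have "\<dots> \<longleftrightarrow> R \<subseteq> \<phi> \<theta>" by auto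
      also have "\<dots> \<longleftrightarrow> \<phi> s \<subseteq> \<phi> \<theta>"
        using congruence_generated(3)[OF A R(2) \<phi>A[OF cB[OF that]]] R(3) by simp
      also have "\<dots> \<longleftrightarrow> s \<subseteq> \<theta>" using ord cB s that by simp
      finally show ?thesis .
    qed
    have "is_lub (Con_c B) s ?T"
    proof (rule least_UpperI)
      show "t \<sqsubseteq>\<^bsub>Con_c B\<^esub> s" if "t \<in> ?T" for t using *[OF s] that unfolding le_c by blast
      show "s \<sqsubseteq>\<^bsub>Con_c B\<^esub> \<theta>" if "\<theta> \<in> Upper (Con_c B) ?T" for \<theta>
      proof -
        have "\<theta> \<in> carrier (Con_c B)" "\<forall>t\<in>?T. t \<subseteq> \<theta>"
          using that T unfolding Upper_def le_c by blast+
        then show ?thesis using *[of \<theta>] unfolding le_c by blast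
      qed
    qed (fact T, fact s)
    then have "s = \<Squnion>\<^bsub>Con_c B\<^esub>?T" using sup_eq_lub[OF po] by simp
    moreover have "?T \<subseteq> {\<delta> x y |x y. x \<in> carrier A \<and> y \<in> carrier A}" using R(2) by auto
    ultimately show "\<exists>T. finite T \<and> T \<subseteq> {\<delta> x y |x y. x \<in> carrier A \<and> y \<in> carrier A} \<and> s = \<Squnion>\<^bsub>Con_c B\<^esub>T"
      by (intro exI[of _ ?T] conjI finite_imageI R(1))
  qed
  ultimately show thesis by (rule that)
qed

section \<open>Free triples for set mappings\<close>

lemma finite_card_ordLess: "finite A \<Longrightarrow> infinite B \<Longrightarrow> |A| <o |B|"
  by (rule finite_ordLess_infinite[OF card_of_Well_order card_of_Well_order]) (simp_all add: Field_card_of)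

text \<open>
  Kuratowski's free set theorem for pairs and \<open>\<aleph>\<^sub>2\<close>. Take \<open>Y \<subseteq> Z\<close> of size \<open>\<aleph>\<^sub>1\<close>. The sets \<open>f i j\<close> with
  \<open>i, j \<in> Y\<close> cover at most \<open>\<aleph>\<^sub>1\<close> points, so some \<open>k\<close> avoids them all. Repeat the argument one cardinal
  below for the set mapping \<open>i \<mapsto> f i k\<close>: a countable infinite \<open>C \<subseteq> Y\<close> leaves room for some \<open>j \<in> Y\<close> outside
  all \<open>f i k\<close> with \<open>i \<in> C\<close>, and the finite set \<open>f j k\<close> cannot contain all of \<open>C\<close>.
\<close>

lemma exists_free_triple:
  assumes big: "cardSuc natLeq <o |Z|"
    and fin: "\<And>i j. i \<in> Z \<Longrightarrow> j \<in> Z \<Longrightarrow> finite (f i j)"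
  obtains i j k where "i \<in> Z" "j \<in> Z" "k \<in> Z" "i \<noteq> j" "j \<noteq> k" "i \<noteq> k"
    "k \<notin> f i j" "i \<notin> f j k" "j \<notin> f i k"
proof -
  let ?r = "cardSuc natLeq"
  have r: "Card_order ?r" by (simp add: cardSuc_Card_order natLeq_Card_order)
  have small: "\<exists>x\<in>A. x \<notin> B" if "|B| <o |A|" for A :: "'a set" and B :: "'a set"
    using that by (meson card_of_mono1 not_ordLess_ordLeq subsetI)
  have "|Field ?r| \<le>o |Z|"
    by (rule ordIso_ordLeq_trans[OF card_of_Field_ordIso[OF r] ordLess_imp_ordLeq[OF big]])
  from internalize_card_of_ordLeq2[THEN iffD1, OF this]
  obtain Y where Y: "Y \<subseteq> Z" "|Field ?r| =o |Y|" by auto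
  have rY: "?r =o |Y|"
    by (rule ordIso_transitive[OF ordIso_symmetric[OF card_of_Field_ordIso[OF r]] Y(2)])
  have natY: "natLeq <o |Y|"
    by (rule ordLess_ordIso_trans[OF cardSuc_greater[OF natLeq_Card_order] rY])
  have infY: "infinite Y"
    using infinite_iff_natLeq_ordLeq[of Y] ordLess_imp_ordLeq[OF natY] by blast
  have YZ: "|Y| <o |Z|"
    by (rule ordIso_ordLess_trans[OF ordIso_symmetric[OF rY] big])
  have small_closure: "|B \<union> (\<Union>p\<in>B'. g p)| \<le>o |B|"
    if "infinite B" "|B'| \<le>o |B|" "\<And>p. p \<in> B' \<Longrightarrow> finite (g p)" for B :: "'a set" and B' :: "'b set" and g
  proof -
    have "|\<Union>p\<in>B'. g p| \<le>o |B|"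
      using that by (intro card_of_UNION_ordLeq_infinite) (auto intro: ordLess_imp_ordLeq finite_card_ordLess)
    then have "|B <+> (\<Union>p\<in>B'. g p)| =o |B|" by (rule card_of_Plus_infinite1[OF that(1)])
    then show ?thesis by (rule ordLeq_ordIso_trans[OF card_of_Un_Plus_ordLeq])
  qed
  have "|Y \<union> (\<Union>p\<in>Y\<times>Y. f (fst p) (snd p))| \<le>o |Y|"
    using Y(1) fin infY
    by (intro small_closure ordIso_imp_ordLeq card_of_Times_same_infinite) (auto simp: subset_iff)
  then obtain k where k: "k \<in> Z" "k \<notin> Y" "\<And>i j. i \<in> Y \<Longrightarrow> j \<in> Y \<Longrightarrow> k \<notin> f i j"
    using small[OF ordLeq_ordLess_trans[OF _ YZ], of "Y \<union> (\<Union>p\<in>Y\<times>Y. f (fst p) (snd p))"] by auto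
  obtain g :: "nat \<Rightarrow> 'a" where g: "inj g" "range g \<subseteq> Y"
    using infinite_countable_subset[OF infY] by blast
  have infC: "infinite (range g)" using g(1) finite_imageD by blast
  have "|range g \<union> (\<Union>i\<in>range g. f i k)| \<le>o |range g|"
    using g(2) Y(1) k(1) fin infC by (intro small_closure card_of_mono1) auto
  moreover have "|range g| \<le>o natLeq"
    by (rule ordLeq_ordIso_trans[OF card_of_image card_of_nat])
  ultimately have "|range g \<union> (\<Union>i\<in>range g. f i k)| <o |Y|"
    using ordLeq_ordLess_trans[OF ordLeq_transitive natY] by simp
  from small[OF this] obtain j where j: "j \<in> Y" "j \<notin> range g" "\<And>i. i \<in> range g \<Longrightarrow> j \<notin> f i k"
    by auto
  have "\<not> range g \<subseteq> f j k"
    using infC fin[of j k] j(1) k(1) Y(1) finite_subset by blast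
  then obtain i where i: "i \<in> range g" "i \<notin> f j k" by blast
  show thesis
    by (rule that[of i j k]) (use i j k g Y in auto)
qed

lemma large_part_of_finite_cover:
  assumes "cardSuc natLeq <o |Z|" "(\<Union>u<m. J u) = Z"
  shows "\<exists>u < (m :: nat). cardSuc natLeq <o |J u|"
proof (rule ccontr)
  let ?r = "cardSuc natLeq"
  have r: "Card_order ?r" by (simp add: cardSuc_Card_order natLeq_Card_order)
  assume no: "\<not> (\<exists>u<m. ?r <o |J u| )"
  have "\<not> ?r <o |J u|" if "u < m" for u using that no by blast
  then have le: "\<forall>u\<in>{..<m}. |J u| \<le>o ?r"
    using not_ordLess_iff_ordLeq[OF card_of_Well_order card_order_on_well_order_on[OF r]] by blast
  have inf: "infinite (Field ?r)"
    using cardSuc_finite[OF natLeq_Card_order] Field_natLeq infinite_UNIV_nat by simp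
  have "|{..<m}| \<le>o ?r"
    using inf by (intro ordLeq_ordIso_trans[OF _ card_of_Field_ordIso[OF r]] ordLess_imp_ordLeq
        finite_card_ordLess) auto
  then have "|\<Union>u\<in>{..<m}. J u| \<le>o ?r"
    using inf r le by (intro card_of_UNION_ordLeq_infinite_Field) auto
  then show False using assms not_ordLess_ordLeq by auto
qed

section \<open>Homomorphisms from free bounded lattices\<close>

text \<open>Freeness of \<open>F\<close> only speaks of targets in the type of \<open>F\<close>. A copy of \<open>K\<close> there, along an injection
  \<open>\<iota>\<close>, makes \<open>K\<close> available as a target.\<close>

definition copy :: "('b \<Rightarrow> 'a) \<Rightarrow> 'b gorder \<Rightarrow> 'a gorder" where
  "copy \<iota> K = \<lparr>carrier = \<iota> ` carrier K, eq = (=),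
     le = (\<lambda>x y. inv_into (carrier K) \<iota> x \<sqsubseteq>\<^bsub>K\<^esub> inv_into (carrier K) \<iota> y)\<rparr>"

lemma copy_bounds:
  assumes "inj_on \<iota> (carrier K)" "A \<subseteq> carrier K"
  shows "is_lub K s A \<Longrightarrow> is_lub (copy \<iota> K) (\<iota> s) (\<iota> ` A)"
    and "is_glb K s A \<Longrightarrow> is_glb (copy \<iota> K) (\<iota> s) (\<iota> ` A)"
proof -
  let ?B = "copy \<iota> K"
  have le: "\<iota> x \<sqsubseteq>\<^bsub>?B\<^esub> \<iota> y \<longleftrightarrow> x \<sqsubseteq>\<^bsub>K\<^esub> y" if "x \<in> carrier K" "y \<in> carrier K" for x y
    using assms(1) that by (simp add: copy_def)
  have A: "\<iota> ` A \<subseteq> carrier ?B" using assms(2) by (auto simp: copy_def)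
  show "is_lub ?B (\<iota> s) (\<iota> ` A)" if s: "is_lub K s A"
  proof (rule least_UpperI[OF _ _ A])
    have sK: "s \<in> carrier K" using s by (rule least_closed)
    then show "\<iota> s \<in> carrier ?B" by (simp add: copy_def)
    show "x \<sqsubseteq>\<^bsub>?B\<^esub> \<iota> s" if "x \<in> \<iota> ` A" for x
      using that least_Upper_above[OF s _ assms(2)] le sK assms(2) by blast
    fix y assume y: "y \<in> Upper ?B (\<iota> ` A)"
    then have "y \<in> carrier ?B" unfolding Upper_def by blast
    then obtain y' where y': "y = \<iota> y'" "y' \<in> carrier K" unfolding copy_def by auto
    have "x \<sqsubseteq>\<^bsub>K\<^esub> y'" if "x \<in> A" for x
    proof -
      have "\<iota> x \<sqsubseteq>\<^bsub>?B\<^esub> \<iota> y'" using Upper_memD[OF y _ A] that y'(1) by blast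
      then show ?thesis using le y'(2) that assms(2) by blast
    qed
    then have "s \<sqsubseteq>\<^bsub>K\<^esub> y'" by (intro least_le[OF s] Upper_memI y'(2))
    then show "\<iota> s \<sqsubseteq>\<^bsub>?B\<^esub> y" using le sK y' by simp
  qed
  show "is_glb ?B (\<iota> s) (\<iota> ` A)" if s: "is_glb K s A"
  proof (rule greatest_LowerI[OF _ _ A])
    have sK: "s \<in> carrier K" using s by (rule greatest_closed)
    then show "\<iota> s \<in> carrier ?B" by (simp add: copy_def)
    show "\<iota> s \<sqsubseteq>\<^bsub>?B\<^esub> x" if "x \<in> \<iota> ` A" for x
      using that greatest_Lower_below[OF s _ assms(2)] le sK assms(2) by blast
    fix y assume y: "y \<in> Lower ?B (\<iota> ` A)"
    then have "y \<in> carrier ?B" unfolding Lower_def by blast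
    then obtain y' where y': "y = \<iota> y'" "y' \<in> carrier K" unfolding copy_def by auto
    have "y' \<sqsubseteq>\<^bsub>K\<^esub> x" if "x \<in> A" for x
    proof -
      have "\<iota> y' \<sqsubseteq>\<^bsub>?B\<^esub> \<iota> x" using y that y'(1) A unfolding Lower_def by blast
      then show ?thesis using le y'(2) that assms(2) by blast
    qed
    then have "y' \<sqsubseteq>\<^bsub>K\<^esub> s" by (intro greatest_le[OF s] Lower_memI y'(2))
    then show "y \<sqsubseteq>\<^bsub>?B\<^esub> \<iota> s" using le sK y' by simp
  qed
qed

lemma copy_lattice:
  assumes K: "bounded_lattice K" and inj: "inj_on \<iota> (carrier K)"
  shows "bounded_lattice (copy \<iota> K)"
    and "bounded_lattice_hom (copy \<iota> K) K (inv_into (carrier K) \<iota>)"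
proof -
  interpret K: bounded_lattice K by fact
  let ?B = "copy \<iota> K" and ?r = "inv_into (carrier K) \<iota>"
  have car: "carrier ?B = \<iota> ` carrier K" and eq: "eq ?B = (=)"
    and le: "x \<sqsubseteq>\<^bsub>?B\<^esub> y \<longleftrightarrow> ?r x \<sqsubseteq>\<^bsub>K\<^esub> ?r y" for x y
    by (simp_all add: copy_def)
  have r: "?r (\<iota> x) = x" if "x \<in> carrier K" for x using inj that by simp
  interpret B: partial_order ?B
  proof
    show "x .=\<^bsub>?B\<^esub> y" if "x \<sqsubseteq>\<^bsub>?B\<^esub> y" "y \<sqsubseteq>\<^bsub>?B\<^esub> x" "x \<in> carrier ?B" "y \<in> carrier ?B" for x y
    proof -
      obtain x' y' where xy: "x = \<iota> x'" "y = \<iota> y'" "x' \<in> carrier K" "y' \<in> carrier K"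
        using \<open>x \<in> carrier ?B\<close> \<open>y \<in> carrier ?B\<close> unfolding car by blast
      then have "x' = y'" using that(1,2) unfolding le by (intro K.le_antisym) (simp_all add: r)
      then show ?thesis using xy by (simp add: eq)
    qed
    show "x \<sqsubseteq>\<^bsub>?B\<^esub> z" if "x \<sqsubseteq>\<^bsub>?B\<^esub> y" "y \<sqsubseteq>\<^bsub>?B\<^esub> z" "x \<in> carrier ?B" "y \<in> carrier ?B" "z \<in> carrier ?B"
      for x y z
      using K.le_trans[of "?r x" "?r y" "?r z"] that inv_into_into[of _ \<iota> "carrier K"]
      unfolding le car by blast
    show "x \<sqsubseteq>\<^bsub>?B\<^esub> x" if "x \<in> carrier ?B" for x
      using that inv_into_into[of x \<iota> "carrier K"] unfolding le car by simp
  qed (simp_all add: eq)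
  have join: "is_lub ?B (\<iota> (x \<squnion>\<^bsub>K\<^esub> y)) {\<iota> x, \<iota> y}" and meet: "is_glb ?B (\<iota> (x \<sqinter>\<^bsub>K\<^esub> y)) {\<iota> x, \<iota> y}"
    if "x \<in> carrier K" "y \<in> carrier K" for x y
    using copy_bounds[OF inj, of "{x, y}"] K.sup_of_two_least[OF that] K.inf_of_two_greatest[OF that] that
    by (simp_all add: join_def meet_def)
  have bot: "least ?B (\<iota> \<bottom>\<^bsub>K\<^esub>) (carrier ?B)" and top: "greatest ?B (\<iota> \<top>\<^bsub>K\<^esub>) (carrier ?B)"
    by (auto simp: least_def greatest_def car le r)
  show B: "bounded_lattice ?B"
  proof unfold_locales
    fix x y assume "x \<in> carrier ?B" "y \<in> carrier ?B"
    then obtain x' y' where "x = \<iota> x'" "y = \<iota> y'" "x' \<in> carrier K" "y' \<in> carrier K"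
      unfolding car by blast
    then show "\<exists>s. is_lub ?B s {x, y}" "\<exists>s. is_glb ?B s {x, y}" using join meet by blast+
  qed (use bot top in blast)+
  interpret B: bounded_lattice ?B by fact
  have "?r (x \<squnion>\<^bsub>?B\<^esub> y) = ?r x \<squnion>\<^bsub>K\<^esub> ?r y \<and> ?r (x \<sqinter>\<^bsub>?B\<^esub> y) = ?r x \<sqinter>\<^bsub>K\<^esub> ?r y"
    if x: "x \<in> carrier ?B" and y: "y \<in> carrier ?B" for x y
  proof -
    obtain x' y' where xy: "x = \<iota> x'" "y = \<iota> y'" "x' \<in> carrier K" "y' \<in> carrier K"
      using x y unfolding car by blast
    have "x \<squnion>\<^bsub>?B\<^esub> y = \<iota> (x' \<squnion>\<^bsub>K\<^esub> y')" "x \<sqinter>\<^bsub>?B\<^esub> y = \<iota> (x' \<sqinter>\<^bsub>K\<^esub> y')"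
      using join_eq_lub[OF B.partial_order_axioms join] meet_eq_glb[OF B.partial_order_axioms meet] xy
      by simp_all
    then show ?thesis using xy by (simp add: r)
  qed
  moreover have "?r \<bottom>\<^bsub>?B\<^esub> = \<bottom>\<^bsub>K\<^esub>" "?r \<top>\<^bsub>?B\<^esub> = \<top>\<^bsub>K\<^esub>"
    using bottom_eq_least[OF B.partial_order_axioms bot] top_eq_greatest[OF B.partial_order_axioms top]
    by (simp_all add: r)
  ultimately show "bounded_lattice_hom ?B K ?r"
    using inv_into_into[of _ \<iota> "carrier K"] B.lattice_axioms K.lattice_axioms
    unfolding bounded_lattice_hom_def lattice_hom_def join_pres_def meet_pres_def car by blast
qed

lemma eval_term_hom:
  assumes "lattice_hom K L g" "\<rho> \<in> UNIV \<rightarrow> carrier K"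
  shows "eval_term K \<rho> t \<in> carrier K \<and> g (eval_term K \<rho> t) = eval_term L (g \<circ> \<rho>) t"
proof -
  interpret lattice K using assms unfolding lattice_hom_def join_pres_def by blast
  show ?thesis
  proof (induction t)
    case (Var n)
    then show ?case using assms(2) by auto
  next
    case (Join s t)
    then show ?case using assms(1) unfolding lattice_hom_def join_pres_def by simp
  next
    case (Meet s t)
    then show ?case using assms(1) unfolding lattice_hom_def meet_pres_def by simp
  qed
qed

text \<open>The copy of \<open>K\<close> satisfies the same identities as \<open>K\<close>, so freeness applies to it; then map back.\<close>

lemma free_bounded_lattice_hom:
  fixes F :: "'f gorder" and K :: "'k gorder" and \<iota> :: "'k \<Rightarrow> 'f"
  assumes F: "free_bounded_lattice K X F" and K: "bounded_lattice K"
    and inj: "inj_on \<iota> (carrier K)" and w: "w \<in> X \<rightarrow> carrier K"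
  obtains g where "bounded_lattice_hom F K g" "\<And>x. x \<in> X \<Longrightarrow> g x = w x"
proof -
  let ?B = "copy \<iota> K" and ?r = "inv_into (carrier K) \<iota>"
  note B = copy_lattice[OF K inj]
  have r_hom: "lattice_hom ?B K ?r" using B(2) unfolding bounded_lattice_hom_def by blast
  have r_inj: "inj_on ?r (carrier ?B)" by (simp add: copy_def inj_on_inv_into)
  have "in_variety_generated_by K ?B"
    unfolding in_variety_generated_by_def satisfies_identity_def
  proof (intro conjI allI impI ballI)
    show "lattice ?B" using B(1) unfolding bounded_lattice_def by blast
    fix s t and \<rho> :: "nat \<Rightarrow> 'f"
    assume id: "\<forall>\<rho>\<in>UNIV \<rightarrow> carrier K. eval_term K \<rho> s = eval_term K \<rho> t"
      and \<rho>: "\<rho> \<in> UNIV \<rightarrow> carrier ?B"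
    have "?r \<circ> \<rho> \<in> UNIV \<rightarrow> carrier K"
      using \<rho> r_hom unfolding lattice_hom_def by (auto simp: Pi_iff)
    then have "eval_term K (?r \<circ> \<rho>) s = eval_term K (?r \<circ> \<rho>) t" using id by blast
    then have "?r (eval_term ?B \<rho> s) = ?r (eval_term ?B \<rho> t)"
      using eval_term_hom[OF r_hom \<rho>, of s] eval_term_hom[OF r_hom \<rho>, of t] by simp
    then show "eval_term ?B \<rho> s = eval_term ?B \<rho> t"
      using r_inj eval_term_hom[OF r_hom \<rho>] unfolding inj_on_def by blast
  qed
  moreover have "\<iota> \<circ> w \<in> X \<rightarrow> carrier ?B" using w by (auto simp: copy_def)
  ultimately obtain h where h: "bounded_lattice_hom F ?B h" "\<forall>x\<in>X. h x = (\<iota> \<circ> w) x"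
    using F B(1) unfolding free_bounded_lattice_def by blast
  show thesis
  proof (rule that)
    show "bounded_lattice_hom F K (?r \<circ> h)"
      using h(1) B(2) lattice_hom_compose[of F ?B h K ?r] unfolding bounded_lattice_hom_def by simp
    show "(?r \<circ> h) x = w x" if "x \<in> X" for x
      using h(2) that w inj by (simp add: Pi_iff)
  qed
qed

lemma generated_induct:
  assumes "bounded_lattice_generated_by X F" "lattice F" "s \<in> carrier F"
    and "\<bottom>\<^bsub>F\<^esub> \<in> carrier F" "\<top>\<^bsub>F\<^esub> \<in> carrier F"
    and "\<And>x. x \<in> X \<Longrightarrow> P x" "P \<bottom>\<^bsub>F\<^esub>" "P \<top>\<^bsub>F\<^esub>"
    and "\<And>x y. x \<in> carrier F \<Longrightarrow> y \<in> carrier F \<Longrightarrow> P x \<Longrightarrow> P y \<Longrightarrow> P (x \<squnion>\<^bsub>F\<^esub> y)"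
    and "\<And>x y. x \<in> carrier F \<Longrightarrow> y \<in> carrier F \<Longrightarrow> P x \<Longrightarrow> P y \<Longrightarrow> P (x \<sqinter>\<^bsub>F\<^esub> y)"
  shows "P s"
proof -
  interpret lattice F by fact
  let ?Y = "{s \<in> carrier F. P s}"
  have "X \<subseteq> ?Y" using assms(1,6) unfolding bounded_lattice_generated_by_def by blast
  moreover have "\<forall>x\<in>?Y. \<forall>y\<in>?Y. x \<squnion>\<^bsub>F\<^esub> y \<in> ?Y \<and> x \<sqinter>\<^bsub>F\<^esub> y \<in> ?Y"
    using assms(9,10) by simp
  moreover have "?Y \<subseteq> carrier F" "\<bottom>\<^bsub>F\<^esub> \<in> ?Y" "\<top>\<^bsub>F\<^esub> \<in> ?Y" using assms by simp_all
  ultimately have "?Y = carrier F" using assms(1) unfolding bounded_lattice_generated_by_def by blast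
  then show ?thesis using assms(3) by blast
qed

lemma bounded_lattice_homD:
  assumes "bounded_lattice_hom F K g"
  shows "g \<bottom>\<^bsub>F\<^esub> = \<bottom>\<^bsub>K\<^esub>" "g \<top>\<^bsub>F\<^esub> = \<top>\<^bsub>K\<^esub>"
    and "x \<in> carrier F \<Longrightarrow> y \<in> carrier F \<Longrightarrow> g (x \<squnion>\<^bsub>F\<^esub> y) = g x \<squnion>\<^bsub>K\<^esub> g y"
    and "x \<in> carrier F \<Longrightarrow> y \<in> carrier F \<Longrightarrow> g (x \<sqinter>\<^bsub>F\<^esub> y) = g x \<sqinter>\<^bsub>K\<^esub> g y"
  using assms unfolding bounded_lattice_hom_def lattice_hom_def join_pres_def meet_pres_def by blast+

text \<open>Every element is the value of a term, which involves only finitely many generators.\<close>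

lemma finite_support:
  assumes F: "bounded_lattice F" and gen: "bounded_lattice_generated_by X F" and s: "s \<in> carrier F"
  shows "\<exists>W. finite W \<and> W \<subseteq> X \<and> (\<forall>g g'. bounded_lattice_hom F K g \<longrightarrow> bounded_lattice_hom F K g' \<longrightarrow>
    (\<forall>x\<in>W. g x = g' x) \<longrightarrow> g s = g' s)"
proof -
  interpret F: bounded_lattice F by fact
  define agree where "agree W s \<longleftrightarrow> (\<forall>g g'. bounded_lattice_hom F K g \<longrightarrow> bounded_lattice_hom F K g' \<longrightarrow>
    (\<forall>x\<in>W. g x = g' x) \<longrightarrow> g s = g' s)" for W s
  have agreeD: "g s = g' s"
    if "agree W s" "bounded_lattice_hom F K g" "bounded_lattice_hom F K g'" "\<forall>x\<in>W. g x = g' x" for W s g g'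
    using that unfolding agree_def by blast
  have "\<exists>W. finite W \<and> W \<subseteq> X \<and> agree W s"
    using gen F.lattice_axioms s F.bottom_closed F.top_closed
  proof (rule generated_induct)
    show "\<exists>W. finite W \<and> W \<subseteq> X \<and> agree W x" if "x \<in> X" for x
      using that by (intro exI[of _ "{x}"]) (auto simp: agree_def)
    show "\<exists>W. finite W \<and> W \<subseteq> X \<and> agree W \<bottom>\<^bsub>F\<^esub>" "\<exists>W. finite W \<and> W \<subseteq> X \<and> agree W \<top>\<^bsub>F\<^esub>"
      by (intro exI[of _ "{}"]; simp add: agree_def bounded_lattice_homD(1,2))+
  next
    fix x y assume xy: "x \<in> carrier F" "y \<in> carrier F"
    assume "\<exists>W. finite W \<and> W \<subseteq> X \<and> agree W x" "\<exists>W. finite W \<and> W \<subseteq> X \<and> agree W y"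
    then obtain W W' where W: "finite W" "W \<subseteq> X" "agree W x" and W': "finite W'" "W' \<subseteq> X" "agree W' y"
      by blast
    have both: "g x = g' x \<and> g y = g' y"
      if "bounded_lattice_hom F K g" "bounded_lattice_hom F K g'" "\<forall>x\<in>W \<union> W'. g x = g' x" for g g'
      using agreeD[OF W(3) that(1,2)] agreeD[OF W'(3) that(1,2)] that(3) by simp
    have agreeI: "agree (W \<union> W') t"
      if t: "\<And>g. bounded_lattice_hom F K g \<Longrightarrow> g t = op (g x) (g y)" for t op
      unfolding agree_def
    proof (intro allI impI)
      fix g g' assume g: "bounded_lattice_hom F K g" "bounded_lattice_hom F K g'" "\<forall>x\<in>W \<union> W'. g x = g' x"
      show "g t = g' t" using both[OF g] t[OF g(1)] t[OF g(2)] by simp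
    qed
    have "agree (W \<union> W') (x \<squnion>\<^bsub>F\<^esub> y)"
      by (rule agreeI[where op = "join K"]) (rule bounded_lattice_homD(3)[OF _ xy])
    moreover have "agree (W \<union> W') (x \<sqinter>\<^bsub>F\<^esub> y)"
      by (rule agreeI[where op = "meet K"]) (rule bounded_lattice_homD(4)[OF _ xy])
    ultimately show "\<exists>W. finite W \<and> W \<subseteq> X \<and> agree W (x \<squnion>\<^bsub>F\<^esub> y)" "\<exists>W. finite W \<and> W \<subseteq> X \<and> agree W (x \<sqinter>\<^bsub>F\<^esub> y)"
      using W(1,2) W'(1,2) by (meson finite_UnI Un_least)+
  qed
  then show ?thesis unfolding agree_def .
qed

text \<open>\<open>r\<close> is a homomorphism into \<open>K\<close> that is only defined on a bounded sublattice \<open>C\<close> of \<open>K\<close>.\<close>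

definition sublattice_hom :: "'k gorder \<Rightarrow> 'k set \<Rightarrow> ('k \<Rightarrow> 'k) \<Rightarrow> bool" where
  "sublattice_hom K C r \<longleftrightarrow> \<bottom>\<^bsub>K\<^esub> \<in> C \<and> \<top>\<^bsub>K\<^esub> \<in> C \<and> r \<bottom>\<^bsub>K\<^esub> = \<bottom>\<^bsub>K\<^esub> \<and> r \<top>\<^bsub>K\<^esub> = \<top>\<^bsub>K\<^esub> \<and>
     (\<forall>x\<in>C. \<forall>y\<in>C. x \<squnion>\<^bsub>K\<^esub> y \<in> C \<and> x \<sqinter>\<^bsub>K\<^esub> y \<in> C \<and>
        r (x \<squnion>\<^bsub>K\<^esub> y) = r x \<squnion>\<^bsub>K\<^esub> r y \<and> r (x \<sqinter>\<^bsub>K\<^esub> y) = r x \<sqinter>\<^bsub>K\<^esub> r y)"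

text \<open>The elements at which the conclusion holds form a bounded sublattice, so it suffices to look at the
  generators.\<close>

lemma sublattice_hom_factor:
  assumes F: "bounded_lattice F" and gen: "bounded_lattice_generated_by X F" and s: "s \<in> carrier F"
    and r: "sublattice_hom K C r"
    and g: "bounded_lattice_hom F K g" and g': "bounded_lattice_hom F K g'"
    and X: "\<And>x. x \<in> X \<Longrightarrow> g x \<in> C \<and> g' x = r (g x)"
  shows "g s \<in> C \<and> g' s = r (g s)"
proof -
  interpret F: bounded_lattice F by fact
  note homs = bounded_lattice_homD[OF g] bounded_lattice_homD[OF g']
  show ?thesis
    using gen F.lattice_axioms s F.bottom_closed F.top_closed
    by (rule generated_induct) (use X r in \<open>simp_all add: homs sublattice_hom_def\<close>)
qed

section \<open>The diamond and the pentagon\<close>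

text \<open>One table serves both lattices, because in each of them incomparable elements are complements.\<close>

lemma five_lattice:
  assumes K: "K = M\<^sub>3 \<or> K = N\<^sub>5"
  shows "bounded_lattice K" "carrier K = UNIV" "\<bottom>\<^bsub>K\<^esub> = Zero5" "\<top>\<^bsub>K\<^esub> = One5"
    and "x \<squnion>\<^bsub>K\<^esub> y = (if x \<sqsubseteq>\<^bsub>K\<^esub> y then y else if y \<sqsubseteq>\<^bsub>K\<^esub> x then x else One5)"
    and "x \<sqinter>\<^bsub>K\<^esub> y = (if x \<sqsubseteq>\<^bsub>K\<^esub> y then x else if y \<sqsubseteq>\<^bsub>K\<^esub> x then y else Zero5)"
proof -
  show car: "carrier K = UNIV" using K by (auto simp: M\<^sub>3_def N\<^sub>5_def)
  have po: "partial_order K" using K by (elim disjE) (unfold_locales; auto simp: M\<^sub>3_def N\<^sub>5_def)+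
  have lub: "is_lub K (if x \<sqsubseteq>\<^bsub>K\<^esub> y then y else if y \<sqsubseteq>\<^bsub>K\<^esub> x then x else One5) {x, y}" for x y
    using K by (elim disjE; cases x; cases y) (auto simp: M\<^sub>3_def N\<^sub>5_def least_def Upper_def)
  have glb: "is_glb K (if x \<sqsubseteq>\<^bsub>K\<^esub> y then x else if y \<sqsubseteq>\<^bsub>K\<^esub> x then y else Zero5) {x, y}" for x y
    using K by (elim disjE; cases x; cases y) (auto simp: M\<^sub>3_def N\<^sub>5_def greatest_def Lower_def)
  have bot: "least K Zero5 (carrier K)" and top: "greatest K One5 (carrier K)"
    using K by (auto simp: M\<^sub>3_def N\<^sub>5_def least_def greatest_def)
  interpret partial_order K by fact
  show "bounded_lattice K" by unfold_locales (use lub glb bot top in blast)+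
  show "\<bottom>\<^bsub>K\<^esub> = Zero5" by (rule bottom_eq_least[OF po bot])
  show "\<top>\<^bsub>K\<^esub> = One5" by (rule top_eq_greatest[OF po top])
  show "x \<squnion>\<^bsub>K\<^esub> y = (if x \<sqsubseteq>\<^bsub>K\<^esub> y then y else if y \<sqsubseteq>\<^bsub>K\<^esub> x then x else One5)"
    by (rule join_eq_lub[OF po lub])
  show "x \<sqinter>\<^bsub>K\<^esub> y = (if x \<sqsubseteq>\<^bsub>K\<^esub> y then x else if y \<sqsubseteq>\<^bsub>K\<^esub> x then y else Zero5)"
    by (rule meet_eq_glb[OF po glb])
qed

lemma inj_five:
  assumes "infinite (UNIV :: 'f set)"
  obtains \<iota> :: "five \<Rightarrow> 'f" where "inj \<iota>"
proof -
  have "(UNIV :: five set) = {Zero5, P5, Q5, R5, One5}" using five.exhaust by auto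
  then have fin: "finite (UNIV :: five set)" by (metis finite.simps)
  obtain B :: "'f set" where B: "finite B" "card B = card (UNIV :: five set)"
    using infinite_arbitrarily_large[OF assms] by blast
  then obtain \<iota> where "bij_betw \<iota> (UNIV :: five set) B" using fin by (metis finite_same_card_bij)
  then show thesis using that bij_betw_def by blast
qed

definition squash :: "five \<Rightarrow> five \<Rightarrow> five" where
  "squash q x = (if x = q \<or> x = One5 then One5 else Zero5)"

text \<open>On the square \<open>{0, p, R, 1}\<close> the maps \<open>squash p\<close> and \<open>squash R\<close> are the two coordinate projections.
  On \<open>{0, P, Q, 1}\<close>, a square in \<open>M\<^sub>3\<close> and a chain in \<open>N\<^sub>5\<close>, the map \<open>squash Q\<close> separates \<open>P\<close> from \<open>Q\<close>.\<close>

lemma sublattice_hom_squash: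
  assumes K: "K = M\<^sub>3 \<or> K = N\<^sub>5"
  shows "p = P5 \<or> p = Q5 \<Longrightarrow> sublattice_hom K {Zero5, p, R5, One5} (squash p)"
    and "p = P5 \<or> p = Q5 \<Longrightarrow> sublattice_hom K {Zero5, p, R5, One5} (squash R5)"
    and "sublattice_hom K {Zero5, P5, Q5, One5} (squash Q5)"
  unfolding sublattice_hom_def five_lattice(3-6)[OF K]
  using K by (elim disjE; simp add: squash_def M\<^sub>3_def N\<^sub>5_def)+

section \<open>Failure of uniform refinement\<close>

text \<open>
  The congruences \<open>a l\<close> and \<open>b l\<close> below live on \<open>L\<close>, but they are only ever tested against kernels of
  homomorphisms \<open>L \<rightarrow> F \<rightarrow> K\<close>.
\<close>

theorem not_WURP_eq_free:
  fixes L :: "'l gorder" and F :: "'f gorder" and X :: "'f set" and h :: "'l \<Rightarrow> 'f"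
  assumes K: "K = M\<^sub>3 \<or> K = N\<^sub>5"
    and L: "lattice L" and F: "free_bounded_lattice K X F"
    and card: "|X| =o cardSuc (cardSuc natLeq)"
    and h: "lattice_hom L F h" and onto: "h ` carrier L = carrier F"
  shows "\<not> WURP_eq (Con_c (lattice_algebra L))"
proof
  let ?A = "lattice_algebra L" and ?S = "Con_c (lattice_algebra L)"
  assume W: "WURP_eq ?S"
  have car: "carrier ?A = carrier L" by (simp add: lattice_algebra_def)
  note A = lattice_algebra_is_algebra[OF L]
  note cg = congruence_generated[OF A, unfolded car]
  have cS: "\<theta> \<in> congruences ?A" if "\<theta> \<in> carrier ?S" for \<theta> using Con_c_closed[OF A] that by blast
  have leS: "le ?S = (\<subseteq>)" by (simp add: Con_c_def)
  interpret S: upper_semilattice ?S by (rule Con_c_semilattice[OF A])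
  note join_S = Con_c_join_subset_iff[OF A]
  interpret F: bounded_lattice F using F unfolding free_bounded_lattice_def by blast
  have gen: "bounded_lattice_generated_by X F" using F unfolding free_bounded_lattice_def by blast
  then have XF: "X \<subseteq> carrier F" unfolding bounded_lattice_generated_by_def by blast

  have r: "Card_order (cardSuc natLeq)" by (simp add: cardSuc_Card_order natLeq_Card_order)
  have big: "cardSuc natLeq <o |X|"
    by (rule ordLess_ordIso_trans[OF cardSuc_greater[OF r] ordIso_symmetric[OF card]])
  have inf: "infinite X"
  proof -
    have "natLeq \<le>o |X|"
      by (rule ordLess_imp_ordLeq[OF ordLess_transitive[OF cardSuc_greater[OF natLeq_Card_order] big]])
    then show ?thesis using infinite_iff_natLeq_ordLeq by blast
  qed
  \<comment> \<open>Split the generators into pairs \<open>u l, v l\<close>, indexed by \<open>X\<close> itself.\<close>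
  obtain p where p: "bij_betw p (X <+> X) X"
    using card_of_Plus_infinite1[OF inf card_of_mono1[OF subset_refl]] card_of_ordIso by blast
  define u where "u l = p (Inl l)" for l
  define v where "v l = p (Inr l)" for l
  have uX: "u l \<in> X" "v l \<in> X" if "l \<in> X" for l
    using that bij_betwE[OF p] unfolding u_def v_def by auto
  have X_cases: "\<exists>l\<in>X. x = u l \<or> x = v l" if "x \<in> X" for x
  proof -
    have "x \<in> p ` (X <+> X)" using p that unfolding bij_betw_def by blast
    then show ?thesis unfolding u_def v_def by auto
  qed

  obtain \<iota> :: "five \<Rightarrow> 'f" where \<iota>: "inj \<iota>"
    using inj_five inf infinite_super by (metis subset_UNIV)
  note K5 = five_lattice[OF K]
  define idx where "idx x = (case inv_into (X <+> X) p x of Inl l \<Rightarrow> l | Inr l \<Rightarrow> l)" for x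
  have idx: "idx (u l) = l" "idx (v l) = l" if "l \<in> X" for l
    using bij_betw_inv_into_left[OF p InlI[OF that]] bij_betw_inv_into_left[OF p InrI[OF that]]
    unfolding idx_def u_def v_def by simp_all

  \<comment> \<open>\<open>G \<sigma>\<close> is the homomorphism \<open>F \<rightarrow> K\<close> that sends \<open>(u l, v l)\<close> to \<open>\<sigma> l\<close>.\<close>
  have "\<exists>g. bounded_lattice_hom F K g \<and> (\<forall>l\<in>X. g (u l) = fst (\<sigma> l) \<and> g (v l) = snd (\<sigma> l))"
    for \<sigma> :: "'f \<Rightarrow> five \<times> five"
  proof -
    define w where "w x = (case inv_into (X <+> X) p x of Inl l \<Rightarrow> fst (\<sigma> l) | Inr l \<Rightarrow> snd (\<sigma> l))" for x
    have w: "w (u l) = fst (\<sigma> l)" "w (v l) = snd (\<sigma> l)" if "l \<in> X" for l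
      using bij_betw_inv_into_left[OF p InlI[OF that]] bij_betw_inv_into_left[OF p InrI[OF that]]
      unfolding w_def u_def v_def by simp_all
    obtain g where "bounded_lattice_hom F K g" "\<And>x. x \<in> X \<Longrightarrow> g x = w x"
      using free_bounded_lattice_hom[OF F K5(1), of \<iota> w] \<iota> unfolding K5(2) by auto
    then show ?thesis using w uX by metis
  qed
  then obtain G where G: "\<And>\<sigma>. bounded_lattice_hom F K (G \<sigma>)"
    and Gu: "\<And>\<sigma> l. l \<in> X \<Longrightarrow> G \<sigma> (u l) = fst (\<sigma> l)" and Gv: "\<And>\<sigma> l. l \<in> X \<Longrightarrow> G \<sigma> (v l) = snd (\<sigma> l)"
    by metis
  have G_bot: "G \<sigma> \<bottom>\<^bsub>F\<^esub> = Zero5" and G_top: "G \<sigma> \<top>\<^bsub>F\<^esub> = One5" for \<sigma>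
    using bounded_lattice_homD(1,2)[OF G] K5(3,4) by simp_all

  have support: "\<exists>W. finite W \<and> (\<forall>\<sigma> \<sigma>'. (\<forall>l\<in>W. \<sigma> l = \<sigma>' l) \<longrightarrow> G \<sigma> s = G \<sigma>' s)"
    if s: "s \<in> carrier F" for s
  proof -
    obtain W where W: "finite W" "W \<subseteq> X" and agree: "\<And>g g'. bounded_lattice_hom F K g \<Longrightarrow>
        bounded_lattice_hom F K g' \<Longrightarrow> \<forall>x\<in>W. g x = g' x \<Longrightarrow> g s = g' s"
      using finite_support[OF F.bounded_lattice_axioms gen s, of K] by metis
    have "G \<sigma> s = G \<sigma>' s" if "\<forall>l\<in>idx ` W. \<sigma> l = \<sigma>' l" for \<sigma> \<sigma>'
    proof (rule agree[OF G G], rule ballI)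
      fix x assume x: "x \<in> W"
      then obtain l where l: "l \<in> X" "x = u l \<or> x = v l" using X_cases W(2) by blast
      then have "\<sigma> l = \<sigma>' l" using that x idx by auto
      then show "G \<sigma> x = G \<sigma>' x" using l by (auto simp: Gu Gv)
    qed
    then show ?thesis using W(1) by blast
  qed

  have factor: "G \<sigma> s \<in> C \<and> G (map_prod r r \<circ> \<sigma>) s = r (G \<sigma> s)"
    if r: "sublattice_hom K C r" and \<sigma>: "\<And>l. \<sigma> l \<in> C \<times> C" and s: "s \<in> carrier F" for C r \<sigma> s
  proof (rule sublattice_hom_factor[OF F.bounded_lattice_axioms gen s r G G])
    fix x assume "x \<in> X"
    then obtain l where l: "l \<in> X" "x = u l \<or> x = v l" using X_cases by blast
    then show "G \<sigma> x \<in> C \<and> G (map_prod r r \<circ> \<sigma>) x = r (G \<sigma> x)"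
      using \<sigma>[of l] by (auto simp: Gu Gv mem_Times_iff)
  qed

  \<comment> \<open>\<open>c \<subseteq> ker \<sigma>\<close> expresses that \<open>c\<close> becomes trivial in \<open>K\<close> under the evaluation \<open>\<sigma>\<close>.\<close>
  define ker where "ker \<sigma> = kernel L (G \<sigma> \<circ> h)" for \<sigma>
  have ker: "ker \<sigma> \<in> congruences ?A" for \<sigma>
    unfolding ker_def
    by (rule kernel_congruence[OF lattice_hom_compose[OF h]]) (use G in \<open>auto simp: bounded_lattice_hom_def\<close>)
  have ker_iff: "(s, t) \<in> ker \<sigma> \<longleftrightarrow> G \<sigma> (h s) = G \<sigma> (h t)" if "s \<in> carrier L" "t \<in> carrier L" for s t \<sigma>
    using that by (simp add: ker_def kernel_def)
  have hF: "h s \<in> carrier F" if "s \<in> carrier L" for s using onto that by blast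

  have "\<exists>s\<in>carrier L. h s = x" if "x \<in> carrier F" for x using onto that by (metis imageE)
  then obtain pre where pre: "\<And>x. x \<in> carrier F \<Longrightarrow> pre x \<in> carrier L \<and> h (pre x) = x" by metis
  define z where "z = pre \<bottom>\<^bsub>F\<^esub>"
  define w where "w = pre \<top>\<^bsub>F\<^esub>"
  define u' where "u' l = pre (u l)" for l
  define v' where "v' l = pre (v l)" for l
  have z: "z \<in> carrier L" "h z = \<bottom>\<^bsub>F\<^esub>" and w: "w \<in> carrier L" "h w = \<top>\<^bsub>F\<^esub>"
    using pre[OF F.bottom_closed] pre[OF F.top_closed] unfolding z_def w_def by auto
  have u': "u' l \<in> carrier L" "h (u' l) = u l" and v': "v' l \<in> carrier L" "h (v' l) = v l" if "l \<in> X" for l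
    using pre uX[OF that] XF unfolding u'_def v'_def by auto

  \<comment> \<open>On the path \<open>z, u' l, v' l, w\<close>, the outer steps lie in \<open>a l\<close> and the middle one in \<open>b l\<close>.\<close>
  define e where "e = congruence_generated ?A {(z, w)}"
  define a where "a l = congruence_generated ?A {(z, u' l), (v' l, w)}" for l
  define b where "b l = congruence_generated ?A {(u' l, v' l)}" for l
  have eS: "e \<in> carrier ?S" using z w unfolding e_def Con_c_def by (auto simp: car)
  have aS: "a l \<in> carrier ?S" and bS: "b l \<in> carrier ?S" if "l \<in> X" for l
    unfolding a_def b_def Con_c_def car using z w u'[OF that] v'[OF that] by auto
  have e_iff: "e \<subseteq> \<theta> \<longleftrightarrow> (z, w) \<in> \<theta>" if "\<theta> \<in> congruences ?A" for \<theta>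
    using cg(3)[OF _ that, of "{(z, w)}"] z w unfolding e_def by simp
  have a_iff: "a l \<subseteq> \<theta> \<longleftrightarrow> (z, u' l) \<in> \<theta> \<and> (v' l, w) \<in> \<theta>"
    and b_iff: "b l \<subseteq> \<theta> \<longleftrightarrow> (u' l, v' l) \<in> \<theta>" if "l \<in> X" "\<theta> \<in> congruences ?A" for l \<theta>
    using cg(3)[OF _ that(2), of "{(z, u' l), (v' l, w)}"] cg(3)[OF _ that(2), of "{(u' l, v' l)}"]
      z w u'[OF that(1)] v'[OF that(1)] unfolding a_def b_def by simp_all
  have "e \<sqsubseteq>\<^bsub>?S\<^esub> a l \<squnion>\<^bsub>?S\<^esub> b l" if l: "l \<in> X" for l
  proof -
    let ?\<theta> = "a l \<squnion>\<^bsub>?S\<^esub> b l"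
    have \<theta>: "?\<theta> \<in> congruences ?A" using aS[OF l] bS[OF l] by (intro cS) simp
    have "a l \<subseteq> ?\<theta>" "b l \<subseteq> ?\<theta>"
      using S.join_left[OF aS bS] S.join_right[OF aS bS] l unfolding leS by auto
    then have "(z, u' l) \<in> ?\<theta>" "(u' l, v' l) \<in> ?\<theta>" "(v' l, w) \<in> ?\<theta>"
      using a_iff[OF l \<theta>] b_iff[OF l \<theta>] by auto
    then have "(z, w) \<in> ?\<theta>" using congruencesD(4)[OF \<theta>] by (meson transD)
    then show ?thesis using e_iff[OF \<theta>] leS by simp
  qed
  then have ab: "a \<in> X \<rightarrow> carrier ?S \<and> b \<in> X \<rightarrow> carrier ?S \<and> (\<forall>l\<in>X. e \<sqsubseteq>\<^bsub>?S\<^esub> a l \<squnion>\<^bsub>?S\<^esub> b l)"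
    using aS bS by blast
  obtain m where m: "\<forall>I :: (('l \<times> 'l) set \<times> ('l \<times> 'l) set) set. WURP_eq_families m I ?S e"
    using W eS unfolding WURP_eq_def WURP_eq_at_def by blast
  from WURP_eq_families_any_index_type[OF m, of X,
    unfolded WURP_eq_families_def, THEN spec, THEN spec, THEN mp, OF ab]
  obtain J c where J: "(\<Union>n<m. J n) = X"
    and c: "\<forall>i\<in>X. \<forall>j\<in>X. c i j \<in> carrier ?S"
      "\<forall>n<m. \<forall>i\<in>J n. \<forall>j\<in>J n. c i j \<sqsubseteq>\<^bsub>?S\<^esub> a i \<squnion>\<^bsub>?S\<^esub> a j \<and> c i j \<sqsubseteq>\<^bsub>?S\<^esub> b i \<squnion>\<^bsub>?S\<^esub> b j"
      "\<forall>n<m. \<forall>i\<in>J n. \<forall>j\<in>J n. e \<sqsubseteq>\<^bsub>?S\<^esub> a j \<squnion>\<^bsub>?S\<^esub> b i \<squnion>\<^bsub>?S\<^esub> c i j"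
      "\<forall>i\<in>X. \<forall>j\<in>X. \<forall>k\<in>X. c i k \<sqsubseteq>\<^bsub>?S\<^esub> c i j \<squnion>\<^bsub>?S\<^esub> c j k"
    by (elim exE conjE)
  obtain n where n: "n < m" "cardSuc natLeq <o |J n|" using large_part_of_finite_cover[OF big J] by blast
  define U where "U = J n"
  have UX: "l \<in> X" if "l \<in> U" for l using that J n(1) unfolding U_def by blast

  have "\<exists>R. finite R \<and> R \<subseteq> carrier L \<times> carrier L \<and> c i j = congruence_generated ?A R"
    if "i \<in> X" "j \<in> X" for i j
  proof -
    have "c i j \<in> carrier ?S" using c(1) that by blast
    then show ?thesis unfolding Con_c_def by (auto simp: car)
  qed
  then obtain R where R: "\<And>i j. i \<in> X \<Longrightarrow> j \<in> X \<Longrightarrow>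
      finite (R i j) \<and> R i j \<subseteq> carrier L \<times> carrier L \<and> c i j = congruence_generated ?A (R i j)"
    by metis
  obtain supp where supp: "\<And>s. s \<in> carrier F \<Longrightarrow>
      finite (supp s) \<and> (\<forall>\<sigma> \<sigma>'. (\<forall>l\<in>supp s. \<sigma> l = \<sigma>' l) \<longrightarrow> G \<sigma> s = G \<sigma>' s)"
    using support by metis
  define f where "f i j = (\<Union>(s, t)\<in>R i j. supp (h s) \<union> supp (h t))" for i j
  have f_fin: "finite (f i j)" if "i \<in> U" "j \<in> U" for i j
  proof -
    note Rij = R[OF UX UX, OF that]
    have "finite (supp (h s) \<union> supp (h t))" if "(s, t) \<in> R i j" for s t
    proof -
      have "s \<in> carrier L" "t \<in> carrier L" using Rij that by blast+
      then show ?thesis using supp[OF hF] by simp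
    qed
    then show ?thesis unfolding f_def using Rij by (intro finite_UN_I) auto
  qed
  have c_iff: "c i j \<subseteq> ker \<sigma> \<longleftrightarrow> (\<forall>(s, t)\<in>R i j. G \<sigma> (h s) = G \<sigma> (h t))" if "i \<in> U" "j \<in> U" for i j \<sigma>
  proof -
    note Rij = R[OF UX UX, OF that]
    have "c i j \<subseteq> ker \<sigma> \<longleftrightarrow> R i j \<subseteq> ker \<sigma>" using Rij cg(3)[OF _ ker] by simp
    also have "\<dots> \<longleftrightarrow> (\<forall>(s, t)\<in>R i j. G \<sigma> (h s) = G \<sigma> (h t))"
      using Rij ker_iff by (auto simp: subset_iff)
    finally show ?thesis .
  qed
  \<comment> \<open>The pairs that generate \<open>c i j\<close> are evaluated from the values at the indices in \<open>f i j\<close> alone.\<close>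
  have local: "c i j \<subseteq> ker \<sigma> \<longleftrightarrow> c i j \<subseteq> ker (\<sigma>(k := d))"
    if ij: "i \<in> U" "j \<in> U" and k: "k \<notin> f i j" for i j k \<sigma> d
  proof -
    have "G \<sigma> (h s) = G (\<sigma>(k := d)) (h s) \<and> G \<sigma> (h t) = G (\<sigma>(k := d)) (h t)"
      if st: "(s, t) \<in> R i j" for s t
    proof -
      have "k \<notin> supp (h s)" "k \<notin> supp (h t)" using k st unfolding f_def by blast+
      then have "\<forall>l\<in>supp (h s). \<sigma> l = (\<sigma>(k := d)) l" "\<forall>l\<in>supp (h t). \<sigma> l = (\<sigma>(k := d)) l" by auto
      moreover have "h s \<in> carrier F" "h t \<in> carrier F" using R[OF UX UX, OF ij] st hF by blast+
      ultimately have "G \<sigma> (h s) = G (\<sigma>(k := d)) (h s)" "G \<sigma> (h t) = G (\<sigma>(k := d)) (h t)"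
        using supp[of "h s"] supp[of "h t"] by blast+
      then show ?thesis by simp
    qed
    then show ?thesis unfolding c_iff[OF ij] by (intro ball_cong) auto
  qed

  \<comment> \<open>The value \<open>(0, 1)\<close> makes \<open>a\<close> trivial, equal components make \<open>b\<close> trivial. With these facts, (i) gives
    the next two statements and (ii) gives the third.\<close>
  have a_a_trivial: "c i j \<subseteq> ker \<sigma>"
    if ij: "i \<in> U" "j \<in> U" and \<sigma>: "\<sigma> i = (Zero5, One5)" "\<sigma> j = (Zero5, One5)" for i j \<sigma>
  proof -
    note X = UX[OF ij(1)] UX[OF ij(2)]
    have "a i \<subseteq> ker \<sigma>" "a j \<subseteq> ker \<sigma>"
      using X \<sigma> by (simp_all add: a_iff ker ker_iff z w u' v' G_bot G_top Gu Gv)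
    then have "a i \<squnion>\<^bsub>?S\<^esub> a j \<subseteq> ker \<sigma>" using join_S[OF aS aS ker] X by simp
    then show ?thesis using c(2) n(1) ij unfolding leS U_def by blast
  qed
  have b_b_trivial: "c i j \<subseteq> ker \<sigma>"
    if ij: "i \<in> U" "j \<in> U" and \<sigma>: "fst (\<sigma> i) = snd (\<sigma> i)" "fst (\<sigma> j) = snd (\<sigma> j)" for i j \<sigma>
  proof -
    note X = UX[OF ij(1)] UX[OF ij(2)]
    have "b i \<subseteq> ker \<sigma>" "b j \<subseteq> ker \<sigma>"
      using X \<sigma> by (simp_all add: b_iff ker ker_iff u' v' Gu Gv)
    then have "b i \<squnion>\<^bsub>?S\<^esub> b j \<subseteq> ker \<sigma>" using join_S[OF bS bS ker] X by simp
    then show ?thesis using c(2) n(1) ij unfolding leS U_def by blast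
  qed
  have b_a_trivial: "\<not> c i j \<subseteq> ker \<sigma>"
    if ij: "i \<in> U" "j \<in> U" and \<sigma>: "fst (\<sigma> i) = snd (\<sigma> i)" "\<sigma> j = (Zero5, One5)" for i j \<sigma>
  proof
    note X = UX[OF ij(1)] UX[OF ij(2)]
    assume "c i j \<subseteq> ker \<sigma>"
    moreover have "b i \<subseteq> ker \<sigma>" "a j \<subseteq> ker \<sigma>"
      using X \<sigma> by (simp_all add: a_iff b_iff ker ker_iff z w u' v' G_bot G_top Gu Gv)
    moreover have cS': "c i j \<in> carrier ?S" using c(1) X by blast
    ultimately have "a j \<squnion>\<^bsub>?S\<^esub> b i \<squnion>\<^bsub>?S\<^esub> c i j \<subseteq> ker \<sigma>"
      using join_S[OF S.join_closed[OF aS bS] cS' ker] join_S[OF aS bS ker] X by simp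
    moreover have "e \<subseteq> a j \<squnion>\<^bsub>?S\<^esub> b i \<squnion>\<^bsub>?S\<^esub> c i j"
      using c(3) n(1) ij unfolding leS U_def by blast
    ultimately have "(z, w) \<in> ker \<sigma>" using e_iff[OF ker] by blast
    then show False by (simp add: ker_iff z w G_bot G_top)
  qed

  \<comment> \<open>Both coordinates of the square \<open>{0, q, R, 1}\<close> make \<open>c i j\<close> trivial: under \<open>?s1\<close> the values at \<open>i\<close> and
    \<open>j\<close> are \<open>(0, 1)\<close>, under \<open>?s2\<close> they have equal components.\<close>
  have vanish: "c i j \<subseteq> ker \<sigma>"
    if ij: "i \<in> U" "j \<in> U" and q: "q = P5 \<or> q = Q5"
      and \<sigma>: "\<And>l. \<sigma> l \<in> {Zero5, q, R5, One5} \<times> {Zero5, q, R5, One5}"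
      and ends: "(\<sigma> i = (Zero5, q) \<and> \<sigma> j = (R5, One5)) \<or> (\<sigma> i = (R5, One5) \<and> \<sigma> j = (Zero5, q))"
    for i j q \<sigma>
    unfolding c_iff[OF ij]
  proof (safe)
    let ?s1 = "map_prod (squash q) (squash q) \<circ> \<sigma>" and ?s2 = "map_prod (squash R5) (squash R5) \<circ> \<sigma>"
    fix s t assume st: "(s, t) \<in> R i j"
    then have F: "h s \<in> carrier F" "h t \<in> carrier F" using R[OF UX UX, OF ij] hF by blast+
    have "c i j \<subseteq> ker ?s1" using q ends by (intro a_a_trivial ij) (auto simp: squash_def)
    moreover have "c i j \<subseteq> ker ?s2" using q ends by (intro b_b_trivial ij) (auto simp: squash_def)
    ultimately have "G ?s1 (h s) = G ?s1 (h t)" "G ?s2 (h s) = G ?s2 (h t)"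
      using st unfolding c_iff[OF ij] by auto
    then have "squash q (G \<sigma> (h s)) = squash q (G \<sigma> (h t))" "squash R5 (G \<sigma> (h s)) = squash R5 (G \<sigma> (h t))"
      "G \<sigma> (h s) \<in> {Zero5, q, R5, One5}" "G \<sigma> (h t) \<in> {Zero5, q, R5, One5}"
      using factor[OF sublattice_hom_squash(1)[OF K q] \<sigma>]
        factor[OF sublattice_hom_squash(2)[OF K q] \<sigma>] F by auto
    then show "G \<sigma> (h s) = G \<sigma> (h t)" using q by (auto simp: squash_def split: if_splits)
  qed

  obtain i j k where ijk: "i \<in> U" "j \<in> U" "k \<in> U" "i \<noteq> j" "j \<noteq> k" "i \<noteq> k"
    and free: "k \<notin> f i j" "i \<notin> f j k" "j \<notin> f i k"
    using exists_free_triple[of U f] n(2) f_fin unfolding U_def by blast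
  define \<sigma> where "\<sigma> = (\<lambda>l. (Zero5, Zero5))(i := (Zero5, P5), j := (R5, One5), k := (Zero5, Q5))"
  have "c i j \<subseteq> ker (\<sigma>(k := (Zero5, Zero5)))"
    by (rule vanish[where q = P5]) (use ijk in \<open>auto simp: \<sigma>_def\<close>)
  then have ij: "c i j \<subseteq> ker \<sigma>" using local[OF ijk(1,2) free(1)] by blast
  have "c j k \<subseteq> ker (\<sigma>(i := (Zero5, Zero5)))"
    by (rule vanish[where q = Q5]) (use ijk in \<open>auto simp: \<sigma>_def\<close>)
  then have jk: "c j k \<subseteq> ker \<sigma>" using local[OF ijk(2,3) free(2)] by blast
  have cijk: "c i j \<in> carrier ?S" "c j k \<in> carrier ?S" "c i k \<subseteq> c i j \<squnion>\<^bsub>?S\<^esub> c j k"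
    using c(1,4) UX ijk unfolding leS by blast+
  then have "c i k \<subseteq> ker \<sigma>" using join_S[OF cijk(1,2) ker] ij jk by blast
  then have ik: "c i k \<subseteq> ker (\<sigma>(j := (Zero5, Zero5)))" using local[OF ijk(1,3) free(3)] by blast

  \<comment> \<open>Composing with \<open>P \<mapsto> 0, Q \<mapsto> 1\<close> on \<open>{0, P, Q, 1}\<close> gives the values \<open>(0, 0)\<close> at \<open>i\<close> and \<open>(0, 1)\<close> at \<open>k\<close>,
    where \<open>b i\<close> and \<open>a k\<close> are trivial; so \<open>c i k\<close> cannot be trivial as well.\<close>
  let ?s = "\<sigma>(j := (Zero5, Zero5))"
  let ?t = "map_prod (squash Q5) (squash Q5) \<circ> ?s"
  have vals: "?s l \<in> {Zero5, P5, Q5, One5} \<times> {Zero5, P5, Q5, One5}" for l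
    using ijk by (auto simp: \<sigma>_def)
  have rt: "G ?t x = squash Q5 (G ?s x)" if "x \<in> carrier F" for x
    by (rule factor[OF sublattice_hom_squash(3)[OF K] _ that, THEN conjunct2]) (rule vals)
  have "\<not> c i k \<subseteq> ker ?t"
    using ijk by (intro b_a_trivial) (auto simp: \<sigma>_def squash_def)
  then obtain s t where st: "(s, t) \<in> R i k" "G ?t (h s) \<noteq> G ?t (h t)"
    unfolding c_iff[OF ijk(1,3)] by blast
  have "s \<in> carrier L" "t \<in> carrier L" using R[OF UX UX, OF ijk(1,3)] st(1) by blast+
  then have "h s \<in> carrier F" "h t \<in> carrier F" using hF by simp_all
  then have "G ?s (h s) \<noteq> G ?s (h t)"
    using st(2) rt by metis
  then show False using ik st(1) unfolding c_iff[OF ijk(1,3)] by blast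
qed

theorem corollary3p7:
  fixes L :: "'l gorder" and F :: "'f gorder" and X :: "'f set" and h :: "'l \<Rightarrow> 'f"
  assumes "lattice L"
    and "free_bounded_lattice M\<^sub>3 X F \<or> free_bounded_lattice N\<^sub>5 X F"
    and "|X| =o cardSuc (cardSuc natLeq)"
    and "lattice_hom L F h" and "h ` carrier L = carrier F"
  shows "\<not> WURP_eq (Con_c (lattice_algebra L)) \<and>
    \<not> (\<exists>(Y :: 'y set) (\<delta> :: 'y \<Rightarrow> 'y \<Rightarrow> ('l \<times> 'l) set).
          V_distance_3_2 (Con_c (lattice_algebra L)) Y \<delta> \<and>
          range_join_generates (Con_c (lattice_algebra L)) Y \<delta>) \<and>
    \<not> (\<exists>A :: ('a, 'o) univ_algebra.
          is_algebra A \<and> almost_permutable_congruences A \<and>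
          lattice_isomorphic (Con (lattice_algebra L)) (Con A))"
proof -
  let ?S = "Con_c (lattice_algebra L)"
  note L = lattice_algebra_is_algebra[OF assms(1)]
  have no_WURP: "\<not> WURP_eq ?S"
    using assms(2) not_WURP_eq_free[OF _ assms(1) _ assms(3-5)] by blast
  moreover have "\<not> (V_distance_3_2 ?S Y \<delta> \<and> range_join_generates ?S Y \<delta>)" for Y :: "'y set" and \<delta>
    using V_distance_3_2_imp_WURP_eq[OF Con_c_semilattice[OF L]] no_WURP by blast
  moreover have "\<not> (is_algebra A \<and> almost_permutable_congruences A \<and>
      lattice_isomorphic (Con (lattice_algebra L)) (Con A))" for A :: "('a, 'o) univ_algebra"
    using almost_permutable_gives_V_distance[OF L]
      V_distance_3_2_imp_WURP_eq[OF Con_c_semilattice[OF L]] no_WURP by blast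
  ultimately show ?thesis by blast
qed

end
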